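(* Let $k$ and $n$ be non-negative integers. (i) Let $p_1,\dots,p_{k+1}$ be primes with $p_i \equiv 2 \pmod 3$ for all $i$, and let $j$ be an integer with $p_{k+1}\nmid j$. Then $$B_{3,7} \left( p_1^2 \cdots p_k^2 p_{k+1}^2 n + \frac{p_1^2 \cdots p_k^2 p_{k+1}\left(3j+ p_{k+1}\right)-1}{3} \right) \equiv 0 \pmod3.$$ (ii) Let $p_1,\dots,p_{k+1}$ be primes with $p_i \equiv 3 \pmod 4$ for all $i$, and let $j$ be an integer with $p_{k+1}\nmid j$. Then $$B_{3,5} \left( p_1^2 \cdots p_k^2 p_{k+1}^2 n + \frac{p_1^2 \cdots p_k^2 p_{k+1}\left(4j+ p_{k+1}\right)-1}{4} \right) \equiv 0 \pmod3.$$ (iii) Let $p_1,\dots,p_{k+1}$ be odd primes with $p_i \not\equiv 1 \pmod 8$ for all $i$, and let $j$ be an integer with $p_{k+1}\nmid j$. Then $$B_{3,2} \left( p_1^2 \cdots p_k^2 p_{k+1}^2 n + \frac{p_1^2 \cdots p_k^2 p_{k+1}\left(8j+ p_{k+1}\right)-1}{8} \right) \equiv 0 \pmod 3.$$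
   Context: For integers $u,v\ge 2$, $B_{u,v}(n)$ is the number of bipartitions $(\alpha,\beta)$ of $n$ with $\alpha$ having no part divisible by $u$ and $\beta$ having no part divisible by $v$; $B_{u,v}(0)=1$ and $\sum_{n\ge0}B_{u,v}(n)q^n=\frac{f_uf_v}{f_1^2}$, $f_t=\prod_{k\ge1}(1-q^{tk})$. By convention $B_{u,v}(m)=0$ for negative $m$. *)

theory Defs
  imports "HOL-Library.Multiset" "HOL-Number_Theory.Number_Theory"
begin

text \<open>A partition is the multiset of its parts.\<close>

definition is_partition :: "nat multiset \<Rightarrow> bool" where
  "is_partition \<alpha> \<longleftrightarrow> (\<forall>a \<in># \<alpha>. 0 < a)"

definition bipartitions :: "nat \<Rightarrow> (nat multiset \<times> nat multiset) set" where
  "bipartitions n =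
     {(\<alpha>, \<beta>). is_partition \<alpha> \<and> is_partition \<beta> \<and> sum_mset \<alpha> + sum_mset \<beta> = n}"

definition regular_bipartitions ::
  "nat \<Rightarrow> nat \<Rightarrow> nat \<Rightarrow> (nat multiset \<times> nat multiset) set" where
  "regular_bipartitions u v n =
     {(\<alpha>, \<beta>) \<in> bipartitions n. (\<forall>a \<in># \<alpha>. \<not> u dvd a) \<and> (\<forall>b \<in># \<beta>. \<not> v dvd b)}"

definition B :: "nat \<Rightarrow> nat \<Rightarrow> int \<Rightarrow> nat" where
  "B u v m = (if m < 0 then 0 else card (regular_bipartitions u v (nat m)))"

text \<open>Finiteness, so that the cardinality above is a genuine count.\<close>

lemma size_le_sum_mset_partition: "is_partition \<alpha> \<Longrightarrow> size \<alpha> \<le> sum_mset \<alpha>"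
  by (induction \<alpha>) (auto simp: is_partition_def)

lemma finite_bipartitions: "finite (bipartitions n)"
proof -
  let ?M = "\<Union>s\<in>{..n}. {\<alpha>. set_mset \<alpha> \<subseteq> {..n} \<and> size \<alpha> = s}"
  have part: "\<alpha> \<in> ?M" if "is_partition \<alpha>" "sum_mset \<alpha> \<le> n" for \<alpha>
  proof -
    have "a \<le> n" if "a \<in># \<alpha>" for a
      using \<open>sum_mset \<alpha> \<le> n\<close> that
      by (auto dest!: multi_member_split)
    moreover have "size \<alpha> \<le> n"
      using size_le_sum_mset_partition[OF that(1)] that(2) by simp
    ultimately show ?thesis by auto
  qed
  have "bipartitions n \<subseteq> ?M \<times> ?M"
    using part unfolding bipartitions_def by fastforce
  moreover have "finite {\<alpha>. set_mset \<alpha> \<subseteq> {..n} \<and> size \<alpha> = s}" for s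
  proof (rule finite_subset)
    show "{\<alpha>. set_mset \<alpha> \<subseteq> {..n} \<and> size \<alpha> = s}
            \<subseteq> mset ` {xs. set xs \<subseteq> {..n} \<and> length xs = s}"
      by (auto, metis (mono_tags, lifting) ex_mset image_eqI mem_Collect_eq set_mset_mset size_mset)
    show "finite (mset ` {xs. set xs \<subseteq> {..n} \<and> length xs = s})"
      by (intro finite_imageI finite_lists_length_eq) simp
  qed
  then have "finite ?M" by blast
  ultimately show ?thesis
    by (meson finite_SigmaI finite_subset)
qed

lemma finite_regular_bipartitions: "finite (regular_bipartitions u v n)"
  by (rule finite_subset[OF _ finite_bipartitions[of n]])
    (auto simp: regular_bipartitions_def)

end

theory Submission
  imports Defs "HOL-Computational_Algebra.Formal_Power_Series"
begin

text \<open>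
  Since \<open>f\<^sub>3 \<equiv> f\<^sub>1\<^sup>3\<close> modulo 3, the generating function of \<open>B\<^sub>3\<^sub>,\<^sub>v\<close> is congruent to \<open>f\<^sub>1 f\<^sub>v\<close>. By
  the pentagonal number theorem (which holds up to any given order by Shanks' finite identity) the
  coefficient of \<open>q\<^sup>N\<close> in \<open>f\<^sub>1 f\<^sub>v\<close> is a quarter of the sum of \<open>\<chi>(x) \<chi>(y)\<close> over the integers with
  \<open>x\<^sup>2 + v y\<^sup>2 = 24 N + 1 + v\<close>, where \<open>\<chi>\<close> is the real character modulo 12. For \<open>v = 7, 5, 2\<close> these
  sums vanish as soon as one of the primes in question divides \<open>(24 N + 1 + v) / gcd(24, 1 + v)\<close> to an
  odd power. If \<open>-v\<close> is not a square modulo \<open>p\<close>, this is because \<open>p\<close> divides both \<open>x\<close> and \<open>y\<close>.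
  Otherwise the solutions with \<open>\<pi> | x + y \<surd>-v\<close>, for a prime ideal \<open>\<pi>\<close> above \<open>p\<close>, are permuted by a
  reflection \<open>\<alpha> \<mapsto> \<alpha>' \<pi> / \<pi>'\<close> (the prime denoting conjugation) that changes the sign of the summand,
  so that only the solutions divisible by \<open>p\<close> contribute and one can descend. The primes 2 and 3, where
  \<open>\<chi>\<close> is ramified, need a rotation relating the solutions for \<open>M\<close> to those for \<open>4 M\<close> or \<open>9 M\<close>.
\<close>

section \<open>The finite pentagonal number theorem\<close>

text \<open>The summand of Shanks' finite form of Euler's theorem. The product over
  \<open>s < i \<le> n\<close> stands for the quotient of the products up to \<open>n\<close> and up
  to \<open>s\<close>, so that no division occurs and any commutative ring will do.\<close>

definition shanks_term :: "'a::comm_ring_1 \<Rightarrow> nat \<Rightarrow> nat \<Rightarrow> 'a" where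
  "shanks_term x n s = (-1) ^ s * (\<Prod>i\<in>{s<..n}. 1 - x ^ i) * x ^ (s * n + s * (s + 1) div 2)"

lemma triangle_Suc: "Suc m * (Suc m + 1) div 2 = m * (m + 1) div 2 + m + 1"
proof -
  have "Suc m * (Suc m + 1) = m * (m + 1) + (m + 1) * 2" by simp
  then show ?thesis by simp
qed

text \<open>The difference of two consecutive Shanks sums telescopes.\<close>

lemma shanks_partial:
  fixes x :: "'a::comm_ring_1"
  assumes "m \<le> n"
  shows "(\<Sum>s\<le>m. shanks_term x (Suc n) s - shanks_term x n s) =
    - ((-1) ^ m * (\<Prod>i\<in>{m<..n}. 1 - x ^ i) * x ^ (m * Suc n + m * (m + 1) div 2 + Suc n))"
  using assms
proof (induction m)
  case 0
  have "{0<..Suc n} = insert (Suc n) {0<..n}" by auto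
  then show ?case by (simp add: shanks_term_def algebra_simps)
next
  case (Suc m)
  define Q where "Q = (\<Prod>i\<in>{Suc m<..n}. 1 - x ^ i)"
  define T where "T = m * (m + 1) div 2"
  have 1: "{Suc m<..Suc n} = insert (Suc n) {Suc m<..n}"
    and 2: "{m<..n} = insert (Suc m) {Suc m<..n}" using Suc.prems by auto
  have a: "shanks_term x (Suc n) (Suc m) =
      (-1) ^ Suc m * ((1 - x ^ Suc n) * Q) * x ^ (Suc m * Suc n + (T + m + 1))"
    unfolding shanks_term_def 1 triangle_Suc T_def Q_def by (subst prod.insert) auto
  have b: "shanks_term x n (Suc m) = (-1) ^ Suc m * Q * x ^ (Suc m * n + (T + m + 1))"
    unfolding shanks_term_def triangle_Suc T_def Q_def by simp
  have c: "(\<Prod>i\<in>{m<..n}. 1 - x ^ i) = (1 - x ^ Suc m) * Q"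
    unfolding 2 Q_def by (subst prod.insert) auto
  have IH: "(\<Sum>s\<le>m. shanks_term x (Suc n) s - shanks_term x n s) =
     - ((-1) ^ m * ((1 - x ^ Suc m) * Q) * x ^ (m * Suc n + T + Suc n))"
    using Suc c by (simp add: T_def)
  show ?case
    unfolding sum.atMost_Suc IH a b triangle_Suc Q_def[symmetric] T_def[symmetric]
    by (simp add: algebra_simps power_add)
qed

text \<open>The generalized pentagonal numbers, with \<open>k\<close> running over all integers. The
  product is even and non-negative, so \<open>div\<close> and \<open>nat\<close> lose
  nothing.\<close>

definition pent :: "int \<Rightarrow> nat" where "pent k = nat (k * (3 * k + 1) div 2)"

lemma pent_double: "2 * int (pent k) = k * (3 * k + 1)"
proof -
  have "even (k * (3 * k + 1))" by auto
  moreover have "0 \<le> k * (3 * k + 1)" by (cases "k \<ge> 0") (auto intro: mult_nonpos_nonpos)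
  ultimately show ?thesis unfolding pent_def by auto
qed

text \<open>This makes the index bounds of the truncated pentagonal sums automatic.\<close>

lemma pent_ge: "nat \<bar>k\<bar> \<le> pent k"
proof -
  have "2 * \<bar>k\<bar> \<le> k * (3 * k + 1)"
  proof (cases "k = 0")
    case False
    then have "\<bar>k\<bar> * 1 \<le> \<bar>k\<bar> * \<bar>k\<bar>" by (intro mult_left_mono) auto
    then show ?thesis by (auto simp: algebra_simps abs_if split: if_splits)
  qed auto
  then show ?thesis using pent_double[of k] by linarith
qed

text \<open>Passing from \<open>n\<close> to \<open>Suc n\<close> adds two terms on the right: the
  telescoped differences, \<open>shanks_partial\<close> with \<open>m = n\<close>, give the index
  \<open>- Suc n\<close>, and the new summand \<open>s = Suc n\<close> gives the index
  \<open>Suc n\<close>.\<close>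

lemma shanks:
  fixes x :: "'a::comm_ring_1"
  shows "(\<Sum>s\<le>n. shanks_term x n s) = (\<Sum>k\<in>{- int n..int n}. (-1) ^ nat \<bar>k\<bar> * x ^ pent k)"
proof (induction n)
  case 0 show ?case by (simp add: shanks_term_def pent_def)
next
  case (Suc n)
  have tri: "2 * int (m * (m + 1) div 2) = int m * (int m + 1)" for m :: nat
  proof -
    have "2 * (m * (m + 1) div 2) = m * (m + 1)" by simp
    then have "int (2 * (m * (m + 1) div 2)) = int (m * (m + 1))" by (rule arg_cong)
    then show ?thesis by (simp only: of_nat_mult of_nat_add of_nat_numeral of_nat_1)
  qed
  have s: "{- int (Suc n)..int (Suc n)} =
      insert (- int (Suc n)) (insert (int (Suc n)) {- int n..int n})" by auto
  have p1: "pent (int (Suc n)) = Suc n * Suc n + Suc n * (Suc n + 1) div 2"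
  proof -
    obtain T where T: "Suc n * (Suc n + 1) div 2 = T" by simp
    have "2 * int (pent (int (Suc n))) = 2 * int (Suc n * Suc n + Suc n * (Suc n + 1) div 2)"
      using tri[of "Suc n"] unfolding pent_double T by (simp add: algebra_simps)
    then show ?thesis by (metis mult_cancel_left of_nat_eq_iff zero_neq_numeral)
  qed
  have p2: "pent (- int (Suc n)) = n * Suc n + n * (n + 1) div 2 + Suc n"
  proof -
    obtain T where T: "n * (n + 1) div 2 = T" by simp
    have "2 * int (pent (- int (Suc n))) = 2 * int (n * Suc n + n * (n + 1) div 2 + Suc n)"
      using tri[of "n"] unfolding pent_double T by (simp add: algebra_simps)
    then show ?thesis by (metis mult_cancel_left of_nat_eq_iff zero_neq_numeral)
  qed
  have "(\<Sum>s\<le>Suc n. shanks_term x (Suc n) s) =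
      (\<Sum>s\<le>n. shanks_term x n s) + (\<Sum>s\<le>n. shanks_term x (Suc n) s - shanks_term x n s)
      + shanks_term x (Suc n) (Suc n)"
    by (simp add: sum_subtractf)
  also have "\<dots> = (\<Sum>k\<in>{- int n..int n}. (-1) ^ nat \<bar>k\<bar> * x ^ pent k)
      + (-1) ^ Suc n * x ^ pent (- int (Suc n)) + (-1) ^ Suc n * x ^ pent (int (Suc n))"
    unfolding Suc.IH shanks_partial[OF order_refl] p1 p2 by (simp add: shanks_term_def)
  also have "\<dots> = (\<Sum>k\<in>{- int (Suc n)..int (Suc n)}. (-1) ^ nat \<bar>k\<bar> * x ^ pent k)"
    unfolding s by (simp add: nat_add_distrib algebra_simps)
  finally show ?case .
qed

text \<open>In Shanks' sum the summand \<open>s = 0\<close> is the product itself, and in every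
  other summand the exponent of \<open>x\<close> is at least \<open>Suc n\<close>. Divisibility
  takes the place of convergence, and the general \<open>x\<close> permits the substitution of
  \<open>fps_X ^ v\<close>.\<close>

lemma pentagonal_dvd:
  fixes x :: "'a::comm_ring_1"
  shows "x ^ Suc n dvd (\<Sum>k\<in>{- int n..int n}. (-1) ^ nat \<bar>k\<bar> * x ^ pent k) - (\<Prod>i\<in>{0<..n}. 1 - x ^ i)"
proof -
  have "(\<Sum>s\<le>n. shanks_term x n s) = shanks_term x n 0 + (\<Sum>s\<in>{0<..n}. shanks_term x n s)"
    by (subst sum.remove[of _ 0]) (auto intro: sum.cong)
  moreover have "shanks_term x n 0 = (\<Prod>i\<in>{0<..n}. 1 - x ^ i)" by (simp add: shanks_term_def)
  moreover have "x ^ Suc n dvd (\<Sum>s\<in>{0<..n}. shanks_term x n s)"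
  proof (rule dvd_sum)
    fix s assume "s \<in> {0<..n}"
    then obtain t where t: "s = Suc t" by (cases s) auto
    have "Suc n \<le> s * n + s * (s + 1) div 2" unfolding t triangle_Suc by simp
    then show "x ^ Suc n dvd shanks_term x n s" unfolding shanks_term_def
      by (intro dvd_mult le_imp_power_dvd)
  qed
  ultimately show ?thesis unfolding shanks[symmetric] by simp
qed

section \<open>Generating functions modulo 3\<close>

text \<open>Congruence modulo the ideal generated by 3 and \<open>fps_X ^ Suc n\<close>; finite
  products can then stand for the infinite products \<open>f\<^sub>t\<close>.\<close>

definition cong3_upto :: "nat \<Rightarrow> int fps \<Rightarrow> int fps \<Rightarrow> bool" where
  "cong3_upto n f g \<longleftrightarrow> (\<forall>i\<le>n. [fps_nth f i = fps_nth g i] (mod 3))"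

lemma cong3_upto_refl [simp]: "cong3_upto n f f" by (simp add: cong3_upto_def)

lemma cong3_upto_sym: "cong3_upto n f g \<Longrightarrow> cong3_upto n g f" by (auto simp: cong3_upto_def cong_sym)

lemma cong3_upto_trans [trans]: "cong3_upto n f g \<Longrightarrow> cong3_upto n g h \<Longrightarrow> cong3_upto n f h"
  by (auto simp: cong3_upto_def intro: cong_trans)

lemma cong3_upto_mult: "cong3_upto n f g \<Longrightarrow> cong3_upto n h k \<Longrightarrow> cong3_upto n (f * h) (g * k)"
  unfolding cong3_upto_def fps_mult_nth by (intro allI impI cong_sum cong_mult) auto

lemma cong3_upto_prod: "(\<And>i. i \<in> A \<Longrightarrow> cong3_upto n (f i) (g i)) \<Longrightarrow> cong3_upto n (prod f A) (prod g A)"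
  by (induction A rule: infinite_finite_induct) (auto intro: cong3_upto_mult)

lemma cong3_upto_power: "cong3_upto n f g \<Longrightarrow> cong3_upto n (f ^ m) (g ^ m)"
  by (induction m) (auto intro: cong3_upto_mult)

lemma cong3_upto_if_X_power_dvd:
  assumes "fps_X ^ Suc n dvd f - g" shows "cong3_upto n f g"
proof -
  obtain h where "f - g = fps_X ^ Suc n * h" using assms by blast
  then have "f = g + fps_X ^ Suc n * h" by (simp add: algebra_simps)
  then have "fps_nth f i = fps_nth g i" if "i \<le> n" for i
    using that by (simp add: fps_X_power_mult_nth del: power_Suc)
  then show ?thesis by (auto simp: cong3_upto_def)
qed

section \<open>Generating functions of partitions with prescribed parts\<close>

definition partitions_in :: "nat set \<Rightarrow> nat \<Rightarrow> nat multiset set" where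
  "partitions_in S n = {\<alpha>. set_mset \<alpha> \<subseteq> S \<and> sum_mset \<alpha> = n}"

definition partition_gf :: "nat set \<Rightarrow> int fps" where
  "partition_gf S = Abs_fps (\<lambda>n. int (card (partitions_in S n)))"

lemma finite_partitions_in: "0 \<notin> S \<Longrightarrow> finite (partitions_in S n)"
proof -
  assume "0 \<notin> S"
  then have "(\<alpha>, {#}) \<in> bipartitions n" if "\<alpha> \<in> partitions_in S n" for \<alpha>
    using that by (auto simp: partitions_in_def bipartitions_def is_partition_def intro!: gr0I)
  then have "partitions_in S n \<subseteq> fst ` bipartitions n" by force
  then show ?thesis using finite_bipartitions finite_subset by blast
qed

lemma partition_gf_empty: "partition_gf {} = 1"
proof (rule fps_ext)
  fix n
  have "partitions_in {} n = (if n = 0 then {{#}} else {})"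
    by (auto simp: partitions_in_def)
  then show "fps_nth (partition_gf {}) n = fps_nth 1 n" by (simp add: partition_gf_def)
qed

text \<open>Removing one copy of \<open>k\<close> matches the partitions of \<open>n\<close> that
  contain \<open>k\<close> with all partitions of \<open>n - k\<close>.\<close>

lemma partition_gf_insert:
  assumes "0 \<notin> S" "k > 0" "k \<notin> S"
  shows "partition_gf (insert k S) * (1 - fps_X ^ k) = partition_gf S"
proof (rule fps_ext)
  fix n
  let ?T = "insert k S"
  have fin: "finite (partitions_in ?T m)" "finite (partitions_in S m)" for m
    using assms finite_partitions_in by auto
  have *: "int (card (partitions_in ?T n)) =
    int (card (partitions_in S n)) + (if n < k then 0 else int (card (partitions_in ?T (n - k))))"
  proof -
    have 1: "partitions_in ?T n = partitions_in S n \<union> {\<alpha> \<in> partitions_in ?T n. k \<in># \<alpha>}"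
      using assms by (auto simp: partitions_in_def)
    have 2: "partitions_in S n \<inter> {\<alpha> \<in> partitions_in ?T n. k \<in># \<alpha>} = {}"
      using assms by (auto simp: partitions_in_def)
    have 3: "card {\<alpha> \<in> partitions_in ?T n. k \<in># \<alpha>} =
      (if n < k then 0 else card (partitions_in ?T (n - k)))"
    proof (cases "n < k")
      case True
      have "k \<le> sum_mset \<alpha>" if "k \<in># \<alpha>" for \<alpha> using that by (auto dest!: multi_member_split)
      then have "{\<alpha> \<in> partitions_in ?T n. k \<in># \<alpha>} = {}" using True
        by (fastforce simp: partitions_in_def)
      then show ?thesis using True by (metis card.empty)
    next
      case False
      have "bij_betw (add_mset k) (partitions_in ?T (n - k)) {\<alpha> \<in> partitions_in ?T n. k \<in># \<alpha>}"
        using False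
        by (intro bij_betwI[where g = "\<lambda>\<alpha>. \<alpha> - {#k#}"])
          (auto simp: partitions_in_def dest: in_diffD dest!: multi_member_split)
      then show ?thesis using False by (simp add: bij_betw_same_card)
    qed
    show ?thesis
      by (subst 1, subst card_Un_disjoint) (use fin 2 3 in auto)
  qed
  show "fps_nth (partition_gf ?T * (1 - fps_X ^ k)) n = fps_nth (partition_gf S) n"
    using * by (simp add: right_diff_distrib fps_X_power_mult_right_nth partition_gf_def)
qed

lemma partition_gf_inverse:
  assumes "finite S" "0 \<notin> S"
  shows "partition_gf S * (\<Prod>k\<in>S. 1 - fps_X ^ k) = 1"
  using assms
proof (induction S)
  case empty show ?case by (simp add: partition_gf_empty)
next
  case (insert k S)
  then have "partition_gf (insert k S) * (1 - fps_X ^ k) = partition_gf S"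
    by (intro partition_gf_insert) auto
  then show ?case using insert by (simp flip: mult.assoc)
qed

text \<open>Parts of a partition of at most \<open>n\<close> are at most \<open>N\<close>, so the
  admissible parts can be cut off at \<open>N\<close>. Splitting by the size \<open>i\<close> of the
  first component gives the Cauchy product.\<close>

lemma card_regular_bipartitions:
  assumes "n \<le> N"
  shows "int (card (regular_bipartitions u v n)) =
    fps_nth (partition_gf {k \<in> {0<..N}. \<not> u dvd k} * partition_gf {k \<in> {0<..N}. \<not> v dvd k}) n"
proof -
  let ?P = "\<lambda>u. partitions_in {k \<in> {0<..N}. \<not> u dvd k}"
  have part: "\<alpha> \<in> ?P u (sum_mset \<alpha>) \<longleftrightarrow> is_partition \<alpha> \<and> (\<forall>a\<in>#\<alpha>. \<not> u dvd a)"
    if "sum_mset \<alpha> \<le> n" for \<alpha> u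
  proof -
    have "a \<le> N" if "a \<in># \<alpha>" for a
      using \<open>sum_mset \<alpha> \<le> n\<close> assms that by (auto dest!: multi_member_split)
    then show ?thesis by (auto simp: partitions_in_def is_partition_def)
  qed
  have s: "sum_mset \<alpha> = i" if "\<alpha> \<in> ?P u i" for \<alpha> u i
    using that by (simp add: partitions_in_def)
  have "regular_bipartitions u v n = (\<Union>i\<in>{0..n}. ?P u i \<times> ?P v (n - i))"
    unfolding set_eq_iff split_paired_All
  proof (intro allI)
    fix \<alpha> \<beta>
    have "(\<alpha>, \<beta>) \<in> regular_bipartitions u v n \<longleftrightarrow>
      sum_mset \<alpha> + sum_mset \<beta> = n \<and> \<alpha> \<in> ?P u (sum_mset \<alpha>) \<and> \<beta> \<in> ?P v (sum_mset \<beta>)"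
    proof (cases "sum_mset \<alpha> + sum_mset \<beta> = n")
      case True
      then have "sum_mset \<alpha> \<le> n" "sum_mset \<beta> \<le> n" by auto
      then show ?thesis unfolding part[OF \<open>sum_mset \<alpha> \<le> n\<close>] part[OF \<open>sum_mset \<beta> \<le> n\<close>]
        using True by (auto simp: regular_bipartitions_def bipartitions_def)
    next
      case False
      then show ?thesis by (auto simp: regular_bipartitions_def bipartitions_def)
    qed
    also have "\<dots> \<longleftrightarrow> (\<exists>i\<in>{0..n}. \<alpha> \<in> ?P u i \<and> \<beta> \<in> ?P v (n - i))" (is "?L \<longleftrightarrow> ?R")
    proof
      assume ?L then show ?R by (intro bexI[of _ "sum_mset \<alpha>"]) auto
    next
      assume ?R then show ?L using s by fastforce
    qed
    also have "\<dots> \<longleftrightarrow> (\<alpha>, \<beta>) \<in> (\<Union>i\<in>{0..n}. ?P u i \<times> ?P v (n - i))" by simp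
    finally show "(\<alpha>, \<beta>) \<in> regular_bipartitions u v n \<longleftrightarrow>
      (\<alpha>, \<beta>) \<in> (\<Union>i\<in>{0..n}. ?P u i \<times> ?P v (n - i))" .
  qed
  moreover have "card (\<Union>i\<in>{0..n}. ?P u i \<times> ?P v (n - i)) =
      (\<Sum>i=0..n. card (?P u i \<times> ?P v (n - i)))"
  proof (rule card_UN_disjoint)
    have "?P u i \<inter> ?P u j = {}" if "i \<noteq> j" for i j
      using s that by blast
    then show "\<forall>i\<in>{0..n}. \<forall>j\<in>{0..n}. i \<noteq> j \<longrightarrow>
        ?P u i \<times> ?P v (n - i) \<inter> ?P u j \<times> ?P v (n - j) = {}" by blast
  qed (auto simp: finite_partitions_in)
  ultimately show ?thesis
    by (simp add: fps_mult_nth partition_gf_def card_cartesian_product)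
qed

section \<open>Euler products and their pentagonal expansions modulo 3\<close>

lemma cong3_upto_if_diff_eq_3_mult: "f - g = 3 * h \<Longrightarrow> cong3_upto n f g"
proof -
  assume "f - g = 3 * h"
  then have "f - g = fps_const 3 * h" by (simp add: numeral_fps_const)
  then have "fps_nth (f - g) i = fps_nth (fps_const 3 * h) i" for i by simp
  then have "fps_nth f i - fps_nth g i = 3 * fps_nth h i" for i by simp
  then show ?thesis by (auto simp: cong3_upto_def cong_iff_dvd_diff)
qed

text \<open>Truncations of \<open>f\<^sub>v\<close>, here as a product and in
  \<open>pent_sum\<close> as a pentagonal series.\<close>

definition euler_prod :: "nat \<Rightarrow> nat \<Rightarrow> int fps" where
  "euler_prod v m = (\<Prod>i\<in>{0<..m}. 1 - (fps_X ^ v) ^ i)"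

definition pent_sum :: "nat \<Rightarrow> nat \<Rightarrow> int fps" where
  "pent_sum v m = (\<Sum>k\<in>{- int m..int m}. (-1) ^ nat \<bar>k\<bar> * (fps_X ^ v) ^ pent k)"

text \<open>The factors with index above \<open>n\<close> are 1 up to order \<open>n\<close> because
  \<open>v \<ge> 1\<close>; the first \<open>n\<close> factors are covered by
  \<open>pentagonal_dvd\<close> at \<open>fps_X ^ v\<close>.\<close>

lemma euler_prod_cong3:
  assumes "n \<le> m" "v \<ge> 1"
  shows "cong3_upto n (euler_prod v m) (pent_sum v n)"
proof -
  have pow: "fps_X ^ Suc n dvd (fps_X ^ v :: int fps) ^ i" if "n < i" for i
  proof -
    have "1 * i \<le> v * i" using assms by (intro mult_right_mono) auto
    then have "Suc n \<le> v * i" using that by linarith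
    then show ?thesis unfolding power_mult[symmetric] by (intro le_imp_power_dvd)
  qed
  have "{0<..m} = {0<..n} \<union> {n<..m}" using assms by auto
  then have "euler_prod v m = euler_prod v n * (\<Prod>i\<in>{n<..m}. 1 - (fps_X ^ v) ^ i)"
    unfolding euler_prod_def by (simp add: prod.union_disjoint)
  moreover have "cong3_upto n (\<Prod>i\<in>{n<..m}. 1 - (fps_X ^ v) ^ i) (\<Prod>i\<in>{n<..m}. 1)"
    by (rule cong3_upto_prod, rule cong3_upto_sym, rule cong3_upto_if_X_power_dvd) (use pow in auto)
  ultimately have "cong3_upto n (euler_prod v m) (euler_prod v n * (\<Prod>i\<in>{n<..m}. 1))"
    using cong3_upto_mult[OF cong3_upto_refl] by (simp only:)
  moreover have "cong3_upto n (pent_sum v n) (euler_prod v n)"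
    unfolding pent_sum_def euler_prod_def
    by (rule cong3_upto_if_X_power_dvd, rule dvd_trans[OF pow pentagonal_dvd]) simp
  ultimately show ?thesis by (auto intro: cong3_upto_sym cong3_upto_trans)
qed

lemma prod_multiples:
  assumes "v \<ge> 1"
  shows "(\<Prod>k\<in>{k \<in> {0<..v * m}. v dvd k}. 1 - fps_X ^ k) = euler_prod v m"
proof -
  have "{k \<in> {0<..v * m}. v dvd k} = (*) v ` {0<..m}" using assms by auto
  moreover have "inj_on ((*) v) {0<..m}" using assms by (auto simp: inj_on_def)
  ultimately show ?thesis by (simp add: euler_prod_def prod.reindex power_mult)
qed

lemma euler_prod_split:
  "euler_prod 1 N = (\<Prod>k\<in>{k \<in> {0<..N}. \<not> v dvd k}. 1 - fps_X ^ k) *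
     (\<Prod>k\<in>{k \<in> {0<..N}. v dvd k}. 1 - fps_X ^ k)"
proof -
  let ?A = "{k \<in> {0<..N}. \<not> v dvd k}" and ?B = "{k \<in> {0<..N}. v dvd k}"
  have "{0<..N} = ?A \<union> ?B" by auto
  then have "euler_prod 1 N = (\<Prod>k\<in>?A \<union> ?B. 1 - fps_X ^ k)"
    by (simp only: euler_prod_def power_one_right)
  also have "\<dots> = (\<Prod>k\<in>?A. 1 - fps_X ^ k) * (\<Prod>k\<in>?B. 1 - fps_X ^ k)"
    by (rule prod.union_disjoint) auto
  finally show ?thesis .
qed

text \<open>The congruence of \<open>1 - y ^ 3\<close> and \<open>(1 - y) ^ 3\<close> modulo 3,
  applied factor by factor.\<close>

lemma euler_prod_3_cong3: "cong3_upto n (euler_prod 3 m) (euler_prod 1 m ^ 3)"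
  unfolding euler_prod_def prod_power_distrib
proof (rule cong3_upto_prod)
  fix i
  have y: "(fps_X ^ 3 :: int fps) ^ i = (fps_X ^ i) ^ 3"
    unfolding power_mult[symmetric] by (simp only: mult.commute)
  have "(1 - y ^ 3) - (1 - y) ^ 3 = 3 * (y - y * y)" for y :: "int fps"
    by (simp add: power3_eq_cube algebra_simps)
  then have "(1 - (fps_X ^ 3) ^ i) - (1 - (fps_X ^ 1) ^ i) ^ 3 =
      3 * (fps_X ^ i - fps_X ^ i * fps_X ^ i :: int fps)" unfolding y power_one_right .
  then show "cong3_upto n (1 - (fps_X ^ 3) ^ i) ((1 - (fps_X ^ 1) ^ i) ^ 3)"
    by (rule cong3_upto_if_diff_eq_3_mult)
qed

text \<open>The generating function \<open>f\<^sub>3 f\<^sub>v / f\<^sub>1\<^sup>2\<close> is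
  congruent to \<open>f\<^sub>1 f\<^sub>v\<close>, since \<open>f\<^sub>3\<close> is congruent to
  \<open>f\<^sub>1\<^sup>3\<close>.\<close>

lemma card_regular_bipartitions_3_cong:
  assumes "v \<ge> 1"
  shows "[int (card (regular_bipartitions 3 v n)) = fps_nth (pent_sum 1 n * pent_sum v n) n] (mod 3)"
proof -
  \<comment> \<open>As \<open>N\<close> is a multiple of 3 and of \<open>v\<close>, the multiples of
    3 and of \<open>v\<close> up to \<open>N\<close> give Euler products with exactly
    \<open>v * n\<close> and \<open>3 * n\<close> factors, both numbers being at least
    \<open>n\<close>.\<close>
  define N where "N = 3 * v * n"
  have le: "n \<le> N" "n \<le> v * n" using assms by (auto simp: N_def)
  define S where "S u = {k \<in> {0<..N}. \<not> u dvd k}" for u :: nat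
  define E where "E = euler_prod 1 N"
  have S: "partition_gf (S u) * E = (\<Prod>k\<in>{k \<in> {0<..N}. u dvd k}. 1 - fps_X ^ k)" for u
    using partition_gf_inverse[of "S u"] unfolding E_def euler_prod_split[of N u]
    by (simp add: S_def flip: mult.assoc)
  have S3: "partition_gf (S 3) * E = euler_prod 3 (v * n)"
    using S[of 3] prod_multiples[of 3 "v * n"] by (simp add: N_def mult.assoc)
  have Sv: "partition_gf (S v) * E = euler_prod v (3 * n)"
    using S[of v] prod_multiples[of v "3 * n"] assms by (simp add: N_def ac_simps)
  \<comment> \<open>\<open>J\<close> inverts the truncated \<open>f\<^sub>1\<close>; inserting
    \<open>J * E\<close> twice replaces the division by \<open>f\<^sub>1\<^sup>2\<close>.\<close>
  define J where "J = partition_gf {0<..N}"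
  have J: "J * E = 1" using partition_gf_inverse[of "{0<..N}"]
    by (simp add: J_def E_def euler_prod_def)
  have P: "cong3_upto n E (pent_sum 1 n)" unfolding E_def by (rule euler_prod_cong3) (use le in auto)
  have "cong3_upto n (euler_prod 3 (v * n)) (euler_prod 1 (v * n) ^ 3)" by (rule euler_prod_3_cong3)
  also have "cong3_upto n \<dots> (pent_sum 1 n ^ 3)"
    by (intro cong3_upto_power euler_prod_cong3) (use le in auto)
  also have "cong3_upto n \<dots> (E ^ 3)" by (intro cong3_upto_power cong3_upto_sym[OF P])
  finally have 3: "cong3_upto n (euler_prod 3 (v * n)) (E ^ 3)" .
  have "partition_gf (S 3) * partition_gf (S v) =
      partition_gf (S 3) * partition_gf (S v) * (J * E) * (J * E)" by (simp add: J)
  also have "\<dots> = J * J * ((partition_gf (S 3) * E) * (partition_gf (S v) * E))" by (simp add: ac_simps)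
  also have "cong3_upto n \<dots> (J * J * (E ^ 3 * pent_sum v n))"
    unfolding S3 Sv by (intro cong3_upto_mult cong3_upto_refl 3 euler_prod_cong3) (use assms in auto)
  also have "J * J * (E ^ 3 * pent_sum v n) = (J * E) * (J * E) * (E * pent_sum v n)"
    by (simp add: power3_eq_cube ac_simps)
  also have "\<dots> = E * pent_sum v n" by (simp add: J)
  also have "cong3_upto n \<dots> (pent_sum 1 n * pent_sum v n)" by (intro cong3_upto_mult P cong3_upto_refl)
  finally show ?thesis
    unfolding card_regular_bipartitions[OF le(1)] S_def[symmetric] by (simp add: cong3_upto_def)
qed

lemma pent_sum_nth:
  "fps_nth (pent_sum 1 n * pent_sum v n) n =
     (\<Sum>(k, l)\<in>{(k, l). \<bar>k\<bar> \<le> int n \<and> \<bar>l\<bar> \<le> int n \<and> pent k + v * pent l = n}. (-1) ^ nat \<bar>k\<bar> * (-1) ^ nat \<bar>l\<bar>)"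
proof -
  let ?I = "{- int n..int n}"
  have m: "fps_nth ((-1) ^ j * f) n = (-1) ^ j * fps_nth f n" for j and f :: "int fps"
    by (cases "even j") auto
  have "fps_nth (pent_sum 1 n * pent_sum v n) n =
    (\<Sum>z\<in>?I \<times> ?I. fps_nth ((-1) ^ nat \<bar>fst z\<bar> * ((-1) ^ nat \<bar>snd z\<bar> * fps_X ^ (pent (fst z) + v * pent (snd z)))) n)"
    unfolding pent_sum_def sum_product sum.cartesian_product fps_sum_nth[symmetric]
    by (intro arg_cong[where f = "\<lambda>f. fps_nth f n"] sum.cong)
      (simp_all add: case_prod_unfold power_add power_mult ac_simps)
  also have "\<dots> = (\<Sum>z\<in>?I \<times> ?I. if pent (fst z) + v * pent (snd z) = n
      then (-1) ^ nat \<bar>fst z\<bar> * (-1) ^ nat \<bar>snd z\<bar> else 0)"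
    unfolding m by (intro sum.cong) (auto simp: fps_X_power_nth)
  also have "\<dots> = (\<Sum>(k, l)\<in>{z \<in> ?I \<times> ?I. pent (fst z) + v * pent (snd z) = n}. (-1) ^ nat \<bar>k\<bar> * (-1) ^ nat \<bar>l\<bar>)"
    unfolding case_prod_unfold by (rule sum.inter_filter[symmetric]) simp
  also have "{z \<in> ?I \<times> ?I. pent (fst z) + v * pent (snd z) = n} =
    {(k, l). \<bar>k\<bar> \<le> int n \<and> \<bar>l\<bar> \<le> int n \<and> pent k + v * pent l = n}" by auto
  finally show ?thesis .
qed

section \<open>Theta sums\<close>

definition chi3 :: "int \<Rightarrow> int" where
  "chi3 x = (if x mod 3 = 1 then 1 else if x mod 3 = 2 then -1 else 0)"

definition chi4 :: "int \<Rightarrow> int" where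
  "chi4 x = (if x mod 4 = 1 then 1 else if x mod 4 = 3 then -1 else 0)"

text \<open>The quadratic character of conductor 12; it is even because both factors are odd. The
  factors are kept apart since signs are computed modulo 3 and modulo 4 separately.\<close>

definition chi :: "int \<Rightarrow> int" where "chi x = chi3 x * chi4 x"

lemma mod3_cases: "x mod 3 = 0 \<or> x mod 3 = 1 \<or> x mod 3 = (2::int)" by presburger

lemma mod4_cases: "x mod 4 = 0 \<or> x mod 4 = 1 \<or> x mod 4 = 2 \<or> x mod 4 = (3::int)" by presburger

lemma mod3_mem: "x mod 3 \<in> {0, 1, 2 :: int}" using mod3_cases[of x] by simp

lemma mod4_mem: "x mod 4 \<in> {0, 1, 2, 3 :: int}" using mod4_cases[of x] by simp

lemma chi3_cong: "x mod 3 = y mod 3 \<Longrightarrow> chi3 x = chi3 y" by (simp add: chi3_def)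

lemma chi4_cong: "x mod 4 = y mod 4 \<Longrightarrow> chi4 x = chi4 y" by (simp add: chi4_def)

lemma chi3_add [simp]: "chi3 (z + 3 * k) = chi3 z" by (simp add: chi3_def)

lemma chi3_1: "chi3 1 = 1" by (simp add: chi3_def)

lemma chi3_eqI: "x = y + 3 * k \<Longrightarrow> chi3 x = chi3 y" by simp

lemma chi3_mult: "chi3 (x * y) = chi3 x * chi3 y"
proof -
  have *: "chi3 (a * b) = chi3 a * chi3 b" if "a \<in> {0, 1, 2}" "b \<in> {0, 1, 2}" for a b
    using that by (elim insertE emptyE) (simp_all add: chi3_def)
  have "chi3 (x * y) = chi3 ((x mod 3) * (y mod 3))" by (rule chi3_cong) (simp only: mod_mult_eq)
  also have "\<dots> = chi3 (x mod 3) * chi3 (y mod 3)"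
    by (intro * mod3_mem)
  also have "\<dots> = chi3 x * chi3 y" by (simp add: chi3_def)
  finally show ?thesis .
qed

lemma chi4_add [simp]: "chi4 (z + 4 * k) = chi4 z" by (simp add: chi4_def)

lemma chi4_mult: "chi4 (x * y) = chi4 x * chi4 y"
proof -
  have *: "chi4 (a * b) = chi4 a * chi4 b" if "a \<in> {0, 1, 2, 3}" "b \<in> {0, 1, 2, 3}" for a b
    using that by (elim insertE emptyE) (simp_all add: chi4_def)
  have "chi4 (x * y) = chi4 ((x mod 4) * (y mod 4))" by (rule chi4_cong) (simp only: mod_mult_eq)
  also have "\<dots> = chi4 (x mod 4) * chi4 (y mod 4)"
    by (intro * mod4_mem)
  also have "\<dots> = chi4 x * chi4 y" by (simp add: chi4_def)
  finally show ?thesis .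
qed

lemma chi_mult: "chi (x * y) = chi x * chi y" by (simp add: chi_def chi3_mult chi4_mult ac_simps)

lemma chi3_minus [simp]: "chi3 (- x) = - chi3 x" using chi3_mult[of "-1" x] by (simp add: chi3_def)

lemma chi4_minus [simp]: "chi4 (- x) = - chi4 x" using chi4_mult[of "-1" x] by (simp add: chi4_def)

lemma chi_minus [simp]: "chi (- x) = chi x" by (simp add: chi_def)

lemma chi3_eq_0_iff: "chi3 x = 0 \<longleftrightarrow> 3 dvd x"
  using mod3_cases[of x] by (elim disjE) (simp_all add: chi3_def dvd_eq_mod_eq_0)

lemma chi4_eq_0_iff: "chi4 x = 0 \<longleftrightarrow> even x"
proof -
  have "even x \<longleftrightarrow> x mod 4 = 0 \<or> x mod 4 = 2" by presburger
  then show ?thesis using mod4_cases[of x] by (elim disjE) (simp_all add: chi4_def)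
qed

lemma chi3_sq: "\<not> 3 dvd x \<Longrightarrow> chi3 x * chi3 x = 1"
  unfolding chi3_eq_0_iff[symmetric] by (simp add: chi3_def split: if_splits)

lemma chi4_sq: "odd x \<Longrightarrow> chi4 x * chi4 x = 1"
  unfolding chi4_eq_0_iff[symmetric] by (simp add: chi4_def split: if_splits)

lemma chi_eq_0_iff: "chi x = 0 \<longleftrightarrow> even x \<or> 3 dvd x"
  by (auto simp: chi_def chi3_eq_0_iff chi4_eq_0_iff)

text \<open>\<open>6 * k + 1\<close> is 1 modulo 3 and \<open>2 * k + 1\<close> modulo 4. This value
  is the sign in the pentagonal number theorem.\<close>

lemma chi_6k1: "chi (6 * k + 1) = (-1) ^ nat \<bar>k\<bar>"
proof -
  have 1: "chi3 (6 * k + 1) = 1" using chi3_add[of 1 "2 * k"] by (simp add: chi3_1 add.commute)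
  have 2: "chi4 (6 * k + 1) = (if even k then 1 else -1)" unfolding chi4_def by presburger
  have "even (nat \<bar>k\<bar>) \<longleftrightarrow> even k" by (simp add: even_nat_iff)
  then show ?thesis by (auto simp: chi_def 1 2)
qed

section \<open>Weighted counts of elements of given norm\<close>

definition reps :: "int \<Rightarrow> int \<Rightarrow> (int \<times> int) set" where
  "reps d M = {(x, y). x ^ 2 + d * y ^ 2 = M}"

definition theta :: "int \<Rightarrow> int \<Rightarrow> int" where
  "theta d M = (\<Sum>(x, y)\<in>reps d M. chi x * chi y)"

lemma finite_reps: "d \<ge> 1 \<Longrightarrow> finite (reps d M)"
proof -
  assume d: "d \<ge> 1"
  have sq: "\<bar>x\<bar> \<le> x ^ 2" for x :: int
  proof (cases "x = 0")
    case False
    then have "\<bar>x\<bar> * 1 \<le> \<bar>x\<bar> * \<bar>x\<bar>" by (intro mult_left_mono) auto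
    then show ?thesis by (simp add: power2_eq_square abs_mult_self_eq)
  qed simp
  have "reps d M \<subseteq> {-M..M} \<times> {-M..M}"
  proof clarify
    fix x y assume "(x, y) \<in> reps d M"
    then have e: "x ^ 2 + d * y ^ 2 = M" by (simp add: reps_def)
    have "1 * y ^ 2 \<le> d * y ^ 2" using d by (intro mult_right_mono) auto
    then have "\<bar>x\<bar> \<le> M" "\<bar>y\<bar> \<le> M" using sq[of x] sq[of y] e zero_le_power2[of x] zero_le_power2[of y]
      by linarith+
    then show "x \<in> {-M..M} \<and> y \<in> {-M..M}" by auto
  qed
  then show ?thesis by (rule finite_subset) simp
qed

text \<open>Completing the square gives \<open>(6 * k + 1) ^ 2 = 24 * pent k + 1\<close>. An integer
  prime to 6 has the form \<open>6 * k + 1\<close> up to a unique sign, so each index pair accounts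
  for four solutions with equal summands.\<close>

lemma theta_pent_sum:
  fixes v n :: nat
  assumes "v \<ge> 1"
  defines "K \<equiv> {(k, l). \<bar>k\<bar> \<le> int n \<and> \<bar>l\<bar> \<le> int n \<and> pent k + v * pent l = n}"
  shows "theta (int v) (24 * int n + 1 + int v) =
    4 * (\<Sum>(k, l)\<in>K. (-1) ^ nat \<bar>k\<bar> * (-1) ^ nat \<bar>l\<bar>)"
proof -
  let ?M = "24 * int n + 1 + int v"
  let ?E = "{1, -1 :: int}"
  define R where "R = {(x, y) \<in> reps (int v) ?M. chi x * chi y \<noteq> 0}"
  have sq: "(6 * k + 1) ^ 2 = 24 * int (pent k) + 1" for k
    using pent_double[of k] by (simp add: power2_eq_square algebra_simps)
  have mem: "(e * (6 * k + 1), f * (6 * l + 1)) \<in> reps (int v) ?M \<longleftrightarrow> (k, l) \<in> K"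
    if "e \<in> ?E" "f \<in> ?E" for e f k l
  proof -
    have ef: "e ^ 2 = 1" "f ^ 2 = 1" using that by auto
    have "(e * (6 * k + 1), f * (6 * l + 1)) \<in> reps (int v) ?M \<longleftrightarrow>
        24 * int (pent k + v * pent l) = 24 * int n"
      unfolding reps_def mem_Collect_eq case_prod_conv power_mult_distrib ef sq
      by (simp add: algebra_simps)
    also have "\<dots> \<longleftrightarrow> pent k + v * pent l = n" by (simp only: mult_cancel_left of_nat_eq_iff) simp
    also have "\<dots> \<longleftrightarrow> (k, l) \<in> K"
    proof -
      have "\<bar>k\<bar> \<le> int n \<and> \<bar>l\<bar> \<le> int n" if "pent k + v * pent l = n"
      proof -
        have "1 * pent l \<le> v * pent l" using assms by (intro mult_right_mono) auto
        then show ?thesis using pent_ge[of k] pent_ge[of l] that by linarith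
      qed
      then show ?thesis by (auto simp: K_def)
    qed
    finally show ?thesis .
  qed
  \<comment> \<open>\<open>chi3 x\<close> is the sign for which \<open>chi3 x * x\<close> is 1
    modulo 6.\<close>
  have ex: "x = chi3 x * (6 * ((chi3 x * x - 1) div 6) + 1) \<and> chi3 x \<in> ?E" if "chi x \<noteq> 0" for x
  proof -
    have "odd x" "\<not> 3 dvd x" using that by (auto simp: chi_eq_0_iff)
    then have "x mod 3 = 1 \<and> (x - 1) mod 6 = 0 \<or> x mod 3 = 2 \<and> (- x - 1) mod 6 = 0" by presburger
    then show ?thesis by (auto simp: chi3_def)
  qed
  have c: "chi (e * (6 * k + 1)) = (-1) ^ nat \<bar>k\<bar>" "chi3 (e * (6 * k + 1)) = e" if "e \<in> ?E" for e k
  proof -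
    have "chi3 (6 * k + 1) = 1" using chi3_add[of 1 "2 * k"] by (simp add: chi3_1 add.commute)
    then show "chi3 (e * (6 * k + 1)) = e" using that by (auto simp del: minus_add_distrib)
    show "chi (e * (6 * k + 1)) = (-1) ^ nat \<bar>k\<bar>" using that chi_minus[of "6 * k + 1"]
      by (auto simp: chi_6k1 simp del: minus_add_distrib chi_minus)
  qed
  have inv: "(e * (e * (6 * k + 1)) - 1) div 6 = k" if "e \<in> ?E" for e k using that by auto
  define i :: "(int \<times> int) \<times> (int \<times> int) \<Rightarrow> int \<times> int"
    where "i = (\<lambda>((k, l), (e, f)). (e * (6 * k + 1), f * (6 * l + 1)))"
  define j :: "int \<times> int \<Rightarrow> (int \<times> int) \<times> (int \<times> int)"
    where "j = (\<lambda>(x, y). (((chi3 x * x - 1) div 6, (chi3 y * y - 1) div 6), (chi3 x, chi3 y)))"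
  have "theta (int v) ?M = (\<Sum>(x, y)\<in>R. chi x * chi y)"
    unfolding theta_def R_def
    by (rule sum.mono_neutral_right) (use assms finite_reps in auto)
  also have "\<dots> = (\<Sum>((k, l), (e, f))\<in>K \<times> (?E \<times> ?E). (-1) ^ nat \<bar>k\<bar> * (-1) ^ nat \<bar>l\<bar>)"
  proof (rule sum.reindex_bij_witness[where i = i and j = j])
    fix z assume "z \<in> R"
    then obtain x y where z: "z = (x, y)" "(x, y) \<in> reps (int v) ?M" "chi x \<noteq> 0" "chi y \<noteq> 0"
      by (auto simp: R_def)
    define k l where "k = (chi3 x * x - 1) div 6" and "l = (chi3 y * y - 1) div 6"
    have x: "x = chi3 x * (6 * k + 1)" "chi3 x \<in> ?E" and y: "y = chi3 y * (6 * l + 1)" "chi3 y \<in> ?E"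
      using ex z unfolding k_def l_def by blast+
    have kl: "(k, l) \<in> K" using mem[OF x(2) y(2), of k l, folded x(1) y(1)] z(2) by simp
    have jz: "j z = ((k, l), (chi3 x, chi3 y))" by (simp add: j_def z k_def l_def)
    show "i (j z) = z" unfolding jz by (simp only: i_def prod.case z(1) x(1)[symmetric] y(1)[symmetric])
    show "j z \<in> K \<times> (?E \<times> ?E)" unfolding jz using kl x(2) y(2) by blast
    have "chi x * chi y = (-1) ^ nat \<bar>k\<bar> * (-1) ^ nat \<bar>l\<bar>"
      using c(1)[OF x(2), of k, folded x(1)] c(1)[OF y(2), of l, folded y(1)] by simp
    then have *: "(case j z of (a, b) \<Rightarrow> case a of (k, l) \<Rightarrow> (\<lambda>(e, f). (-1) ^ nat \<bar>k\<bar> * (-1) ^ nat \<bar>l\<bar>) b) =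
        (case z of (x, y) \<Rightarrow> chi x * chi y)"
      unfolding jz unfolding z(1) prod.case by (rule sym)
    show "(case j z of (a, b) \<Rightarrow> (case a of (k, l) \<Rightarrow> \<lambda>(e, f). (-1) ^ nat \<bar>k\<bar> * (-1) ^ nat \<bar>l\<bar>) b) =
        (case z of (x, y) \<Rightarrow> chi x * chi y)" using * by (simp only: case_prod_unfold)
  next
    fix t assume "t \<in> K \<times> (?E \<times> ?E)"
    then obtain k l e f where t: "t = ((k, l), (e, f))" "(k, l) \<in> K" "e \<in> ?E" "f \<in> ?E"
      by (cases t) auto
    show "j (i t) = t" using t by (simp add: i_def j_def c inv del: insert_iff)
    show "i t \<in> R" using t mem[OF t(3,4)] by (simp add: i_def R_def c del: insert_iff)
  qed
  also have "\<dots> = 4 * (\<Sum>(k, l)\<in>K. (-1) ^ nat \<bar>k\<bar> * (-1) ^ nat \<bar>l\<bar>)"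
    unfolding case_prod_unfold sum.cartesian_product' by (simp add: sum_distrib_left)
  finally show ?thesis .
qed

text \<open>Solutions divisible by \<open>p\<close> are \<open>p\<close> times solutions for
  \<open>M\<close> divided by \<open>p ^ 2\<close>, so the exponent drops by 2. At exponent 1 there
  are none, because their norm would be divisible by \<open>p ^ 2\<close>. The constant
  \<open>c\<close> is 1 in the inert case and -1 in the split case.\<close>

lemma theta_odd_power:
  fixes p :: int
  assumes p: "prime p"
    and step: "\<And>M. p dvd M \<Longrightarrow> theta d M =
      c * (\<Sum>(x, y)\<in>{(x, y) \<in> reps d M. p dvd x \<and> p dvd y}. chi x * chi y)"
    and w: "\<not> p dvd w"
  shows "theta d (p ^ (2 * e + 1) * w) = 0"
proof (induction e)
  case 0
  have empty: "{(x, y) \<in> reps d (p * w). p dvd x \<and> p dvd y} = {}"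
  proof -
    have False if "(p * x) ^ 2 + d * (p * y) ^ 2 = p * w" for x y
    proof -
      have "p * (p * (x ^ 2 + d * y ^ 2)) = p * w" using that
        by (simp add: power2_eq_square algebra_simps)
      then have "p dvd w" using p by (metis dvd_triv_left mult_cancel_left not_prime_0)
      then show False using w by simp
    qed
    then show ?thesis by (fastforce simp: reps_def elim!: dvdE)
  qed
  show ?case using step[OF dvd_triv_left, of w] unfolding empty by simp
next
  case (Suc e)
  let ?M = "p ^ (2 * e + 1) * w"
  have eq: "p ^ (2 * Suc e + 1) * w = p ^ 2 * ?M" by (simp add: power2_eq_square)
  have "p \<noteq> 0" using p by auto
  then have m: "(p * x, p * y) \<in> reps d (p ^ 2 * ?M) \<longleftrightarrow> (x, y) \<in> reps d ?M" for x y
  proof -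
    have "(p * x) ^ 2 + d * (p * y) ^ 2 = p ^ 2 * (x ^ 2 + d * y ^ 2)"
      by (simp add: power2_eq_square algebra_simps)
    then show ?thesis using \<open>p \<noteq> 0\<close> by (simp add: reps_def)
  qed
  have "(\<Sum>(x, y)\<in>{(x, y) \<in> reps d (p ^ 2 * ?M). p dvd x \<and> p dvd y}. chi x * chi y) =
      (\<Sum>(x, y)\<in>reps d ?M. chi (p * x) * chi (p * y))"
    by (rule sum.reindex_bij_witness[where i = "\<lambda>(x, y). (p * x, p * y)" and j = "\<lambda>(x, y). (x div p, y div p)"])
      (use \<open>p \<noteq> 0\<close> m in \<open>auto elim!: dvdE\<close>)
  also have "\<dots> = chi p * chi p * theta d ?M"
    unfolding theta_def sum_distrib_left case_prod_unfold chi_mult by (simp add: ac_simps)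
  also have "\<dots> = 0" using Suc.IH by simp
  finally have "(\<Sum>(x, y)\<in>{(x, y) \<in> reps d (p ^ 2 * ?M). p dvd x \<and> p dvd y}. chi x * chi y) = 0" .
  then show ?case unfolding eq using step[of "p ^ 2 * ?M"] by (simp add: power2_eq_square)
qed

text \<open>If \<open>p\<close> did not divide \<open>y\<close>, then \<open>x / y\<close> modulo
  \<open>p\<close> would be a square root of \<open>-d\<close>. Hence \<open>p\<close> divides both
  coordinates of every solution.\<close>

lemma theta_inert:
  fixes p :: int
  assumes p: "prime p" and nr: "\<And>r. \<not> p dvd r ^ 2 + d" and w: "\<not> p dvd w"
  shows "theta d (p ^ (2 * e + 1) * w) = 0"
proof (rule theta_odd_power[where c = 1, OF p _ w])
  fix M assume M: "p dvd M"
  have "p dvd x \<and> p dvd y" if "x ^ 2 + d * y ^ 2 = M" for x y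
  proof (cases "p dvd y")
    case True
    then have "p dvd d * y ^ 2" by (simp add: power2_eq_square)
    then have "p dvd x ^ 2" using that M by (metis dvd_add_left_iff)
    then show ?thesis using True p prime_dvd_power by blast
  next
    case False
    then have "coprime y p" using p by (simp add: prime_imp_coprime coprime_commute)
    then obtain z where z: "[y * z = 1] (mod p)" using cong_solve_coprime_int by blast
    then have z: "p dvd y * z - 1" by (simp add: cong_iff_dvd_diff)
    have "p dvd M * z ^ 2 - d * (y * z - 1) * (y * z + 1)"
      by (intro dvd_diff dvd_mult2[OF M] dvd_mult2[OF dvd_mult[OF z]])
    also have "M * z ^ 2 - d * (y * z - 1) * (y * z + 1) = (x * z) ^ 2 + d"
      using that by (auto simp: power2_eq_square algebra_simps)
    finally show ?thesis using nr by blast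
  qed
  then have "{(x, y) \<in> reps d M. p dvd x \<and> p dvd y} = reps d M" by (auto simp: reps_def)
  then show "theta d M = 1 * (\<Sum>(x, y)\<in>{(x, y) \<in> reps d M. p dvd x \<and> p dvd y}. chi x * chi y)"
    by (simp add: theta_def)
qed

text \<open>
  Writing \<open>\<pi>\<^sup>2 = a + b \<surd>-d\<close> (up to a factor 2), the reflection \<open>\<alpha> \<mapsto> \<alpha>' \<pi>\<^sup>2 / p\<close> maps \<open>(x, y)\<close> to
  \<open>((a x + d b y) / p, (b x - a y) / p)\<close>; it is an involution on the solutions with \<open>p | b x - a y\<close>.
\<close>

lemma theta_split:
  fixes p a b d :: int
  assumes p: "prime p" "odd p" and d: "d \<ge> 2" "\<not> p dvd d"
    and ab: "a ^ 2 + d * b ^ 2 = p ^ 2" "b \<noteq> 0"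
    and sign: "\<And>x y X Y. p * X = a * x + d * b * y \<Longrightarrow> p * Y = b * x - a * y \<Longrightarrow>
      chi X * chi Y = - (chi x * chi y)"
    and w: "\<not> p dvd w"
  shows "theta d (p ^ (2 * e + 1) * w) = 0"
proof (rule theta_odd_power[where c = "-1", OF p(1) _ w])
  have p0: "p > 0" using p prime_gt_0_int by blast
  have *: "p dvd a \<longleftrightarrow> p dvd b"
  proof
    assume "p dvd a"
    then have "p dvd p ^ 2 - a ^ 2" by (simp add: power2_eq_square)
    also have "p ^ 2 - a ^ 2 = d * b ^ 2" using ab by simp
    finally have "p dvd b ^ 2" using p d by (simp add: prime_dvd_mult_iff)
    then show "p dvd b" using p prime_dvd_power by blast
  next
    assume "p dvd b"
    then have "p dvd p ^ 2 - d * b ^ 2" by (simp add: power2_eq_square)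
    also have "p ^ 2 - d * b ^ 2 = a ^ 2" using ab by simp
    finally show "p dvd a" using p prime_dvd_power by blast
  qed
  \<comment> \<open>Otherwise \<open>d * b ^ 2\<close> would be at least \<open>2 * p ^ 2\<close>,
    since \<open>b \<noteq> 0\<close> and \<open>d \<ge> 2\<close>.\<close>
  have b: "\<not> p dvd b"
  proof
    assume "p dvd b"
    then obtain b' where b': "b = p * b'" by blast
    have "1 \<le> \<bar>b'\<bar>" using ab(2) b' by auto
    then have "1 ^ 2 \<le> \<bar>b'\<bar> ^ 2" by (intro power_mono) auto
    then have "2 * 1 \<le> d * b' ^ 2" using d by (intro mult_mono) auto
    then have "p ^ 2 * 2 \<le> p ^ 2 * (d * b' ^ 2)" by (intro mult_left_mono) auto
    also have "\<dots> = d * b ^ 2" by (simp add: b' power2_eq_square)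
    also have "\<dots> \<le> p ^ 2" using ab(1) zero_le_power2[of a] by linarith
    finally show False using p0 by simp
  qed
  with * have a: "\<not> p dvd a" by simp
  fix M assume M: "p dvd M"
  let ?g = "\<lambda>(x, y). chi x * chi y"
  define A where "A = {(x, y) \<in> reps d M. p dvd b * x - a * y}"
  define A' where "A' = {(x, y) \<in> reps d M. p dvd b * x + a * y}"
  have "finite (reps d M)" using finite_reps[of d M] d by simp
  then have fin: "finite A" "finite A'"
    by (rule rev_finite_subset, force simp: A_def A'_def)+
  \<comment> \<open>\<open>A\<close> and \<open>A'\<close> hold the solutions divisible by one or
    the other prime above \<open>p\<close>; the product of the two linear forms is
    \<open>b ^ 2 * M - p ^ 2 * y ^ 2\<close>, hence divisible by \<open>p\<close>.\<close>
  have "reps d M = A \<union> A'"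
  proof -
    have "p dvd b * x - a * y \<or> p dvd b * x + a * y" if "x ^ 2 + d * y ^ 2 = M" for x y
    proof -
      have "(b * x - a * y) * (b * x + a * y) = b ^ 2 * (x ^ 2 + d * y ^ 2) - (a ^ 2 + d * b ^ 2) * y ^ 2"
        by (simp add: power2_eq_square algebra_simps)
      also have "\<dots> = b ^ 2 * M - p ^ 2 * y ^ 2" by (simp add: ab that)
      finally have "p dvd (b * x - a * y) * (b * x + a * y)" using M
        by (simp add: power2_eq_square)
      then show ?thesis using p by (simp add: prime_dvd_mult_iff)
    qed
    then show ?thesis by (auto simp: A_def A'_def reps_def)
  qed
  then have 1: "theta d M = sum ?g A + sum ?g A' - sum ?g (A \<inter> A')"
    unfolding theta_def using sum_Un[OF fin(1,2)] by simp
  have 2: "A \<inter> A' = {(x, y) \<in> reps d M. p dvd x \<and> p dvd y}"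
  proof -
    have *: "p dvd x \<and> p dvd y" if "p dvd b * x - a * y" "p dvd b * x + a * y" for x y
    proof -
      have "p dvd (b * x - a * y) + (b * x + a * y)" "p dvd (b * x + a * y) - (b * x - a * y)"
        using that by (blast intro: dvd_add dvd_diff)+
      then have "p dvd 2 * (b * x)" "p dvd 2 * (a * y)" by (simp_all add: algebra_simps)
      moreover have "\<not> p dvd 2" using zdvd_imp_le[of p 2] p0 p prime_gt_1_int[OF p(1)] by (cases "p = 2") auto
      ultimately show ?thesis using p a b by (simp add: prime_dvd_mult_iff)
    qed
    have "(x, y) \<in> A \<inter> A' \<longleftrightarrow> (x, y) \<in> {(x, y) \<in> reps d M. p dvd x \<and> p dvd y}" for x y
      using *[of x y] by (auto simp: A_def A'_def)
    then show ?thesis unfolding set_eq_iff split_paired_All by blast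
  qed
  have 3: "sum ?g A' = sum ?g A"
    by (rule sum.reindex_bij_witness[where i = "\<lambda>(x, y). (x, - y)" and j = "\<lambda>(x, y). (x, - y)"])
      (auto simp: A_def A'_def reps_def)
  \<comment> \<open>\<open>b\<close> is invertible modulo \<open>p\<close>, so integrality of the
    second reflected coordinate implies that of the first.\<close>
  have dvdX: "p dvd a * x + d * b * y" if "p dvd b * x - a * y" for x y
  proof -
    have "b * (a * x + d * b * y) = a * (b * x - a * y) + p ^ 2 * y"
      unfolding ab(1)[symmetric] by (simp add: power2_eq_square algebra_simps)
    then have "p dvd b * (a * x + d * b * y)" using that by (simp add: power2_eq_square)
    then show ?thesis using p b by (simp add: prime_dvd_mult_iff)
  qed
  define \<phi> where "\<phi> = (\<lambda>(x, y). ((a * x + d * b * y) div p, (b * x - a * y) div p))"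
  have \<phi>: "\<phi> z \<in> A \<and> \<phi> (\<phi> z) = z \<and> ?g (\<phi> z) = - ?g z" if z: "z \<in> A" for z
  proof -
    obtain x y where xy: "z = (x, y)" by (cases z)
    have "p dvd b * x - a * y" and M: "x ^ 2 + d * y ^ 2 = M" using z by (auto simp: A_def xy reps_def)
    then obtain X Y where X: "a * x + d * b * y = p * X" and Y: "b * x - a * y = p * Y"
      using dvdX by (meson dvdE)
    have f: "\<phi> z = (X, Y)" using p0 by (simp add: \<phi>_def xy X Y)
    have "p * (a * X + d * b * Y) = a * (p * X) + d * b * (p * Y)" by (simp add: algebra_simps)
    also have "\<dots> = (a ^ 2 + d * b ^ 2) * x"
      unfolding X[symmetric] Y[symmetric] by (simp add: power2_eq_square algebra_simps)
    finally have X': "a * X + d * b * Y = p * x" using p0 ab by (simp add: power2_eq_square)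
    have "p * (b * X - a * Y) = b * (p * X) - a * (p * Y)" by (simp add: algebra_simps)
    also have "\<dots> = (a ^ 2 + d * b ^ 2) * y"
      unfolding X[symmetric] Y[symmetric] by (simp add: power2_eq_square algebra_simps)
    finally have Y': "b * X - a * Y = p * y" using p0 ab by (simp add: power2_eq_square)
    have "p ^ 2 * (X ^ 2 + d * Y ^ 2) = (p * X) ^ 2 + d * (p * Y) ^ 2"
      by (simp add: power2_eq_square algebra_simps)
    also have "\<dots> = (a ^ 2 + d * b ^ 2) * (x ^ 2 + d * y ^ 2)"
      unfolding X[symmetric] Y[symmetric] by (simp add: power2_eq_square algebra_simps)
    finally have "p ^ 2 * (X ^ 2 + d * Y ^ 2) = p ^ 2 * M" by (simp only: ab(1) M)
    then have "X ^ 2 + d * Y ^ 2 = M" using p0 by simp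
    then have "\<phi> z \<in> A" unfolding f A_def reps_def using Y' by simp
    moreover have "\<phi> (\<phi> z) = z" unfolding f using p0 by (simp add: \<phi>_def xy X' Y')
    moreover have "?g (\<phi> z) = - ?g z" using sign[OF X[symmetric] Y[symmetric]] f unfolding xy by simp
    ultimately show ?thesis by blast
  qed
  \<comment> \<open>The reflection negates the sum over \<open>A\<close>, which is therefore 0, and
    so is the sum over \<open>A'\<close>. Inclusion-exclusion leaves minus the sum over the
    intersection, whence the constant -1.\<close>
  have "sum ?g A = (\<Sum>z\<in>A. - ?g z)"
  proof (rule sum.reindex_bij_witness[where i = \<phi> and j = \<phi>])
    fix z assume "z \<in> A"
    from \<phi>[OF this] show "\<phi> (\<phi> z) = z" "\<phi> z \<in> A" "\<phi> (\<phi> z) = z" "\<phi> z \<in> A" "- ?g (\<phi> z) = ?g z"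
      by simp_all
  qed
  then have "sum ?g A = 0" by (simp add: sum_negf)
  then show "theta d M = -1 * (\<Sum>(x, y)\<in>{(x, y) \<in> reps d M. p dvd x \<and> p dvd y}. chi x * chi y)"
    using 1 2 3 by simp
qed

section \<open>Representing primes by binary quadratic forms\<close>

text \<open>Thue's lemma. With \<open>t\<close> least such that \<open>t ^ 2 \<ge> p\<close>, there
  are more than \<open>p\<close> pairs below \<open>t\<close>, so two of them agree in
  \<open>i - r * j\<close> modulo \<open>p\<close>. Their difference has entries smaller than
  \<open>t\<close> in absolute value, whose squares are below \<open>p\<close> by
  minimality.\<close>

lemma thue:
  fixes p r :: int
  assumes p: "prime p"
  obtains u v where "u \<noteq> 0 \<or> v \<noteq> 0" "u ^ 2 < p" "v ^ 2 < p" "p dvd u - r * v"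
proof -
  have p1: "p > 1" using p prime_gt_1_int by blast
  define t where "t = (LEAST t::nat. p \<le> int t ^ 2)"
  have ex: "p \<le> int (nat p) ^ 2" using p1 by (simp add: power2_eq_square)
  have t: "p \<le> int t ^ 2" unfolding t_def by (rule LeastI[of _ "nat p"]) (rule ex)
  have least: "int i ^ 2 < p" if "i < t" for i
    using not_less_Least[of i "\<lambda>t. p \<le> int t ^ 2"] that unfolding t_def by simp
  \<comment> \<open>A prime is not a square; this makes the pigeonhole inequality strict.\<close>
  have "p \<noteq> int t ^ 2"
  proof
    assume eq: "p = int t ^ 2"
    then have "int t dvd p" by (simp add: power2_eq_square)
    then have "int t = 1 \<or> int t = p"
      using p unfolding prime_int_iff by (metis of_nat_0_le_iff)
    then show False
    proof
      assume "int t = p"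
      then have "p = p ^ 2" using eq by metis
      then show False using p1 by (simp add: power2_eq_square)
    next
      assume "int t = 1"
      then show False using eq p1 by (simp only: power_one)
    qed
  qed
  with t have tt: "p < int t ^ 2" by simp
  let ?S = "{..<t} \<times> {..<t}"
  let ?f = "\<lambda>(i, j). (int i - r * int j) mod p"
  have "?f ` ?S \<subseteq> {0..<p}" using p1 by auto
  then have "card (?f ` ?S) \<le> card {0..<p}" by (intro card_mono) auto
  also have "\<dots> = nat p" by simp
  also have "\<dots> < card ?S" using tt p1 by (simp add: power2_eq_square card_cartesian_product nat_less_iff)
  finally have "\<not> inj_on ?f ?S" by (rule pigeonhole)
  then obtain i j i' j' where ij: "i < t" "j < t" "i' < t" "j' < t"
    "(i, j) \<noteq> (i', j')" "(int i - r * int j) mod p = (int i' - r * int j') mod p"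
    unfolding inj_on_def by auto
  show ?thesis
  proof (rule that[of "int i - int i'" "int j - int j'"])
    show "int i - int i' \<noteq> 0 \<or> int j - int j' \<noteq> 0" using ij by auto
    have sq: "(int a - int b) ^ 2 < p" if "a < t" "b < t" for a b
    proof -
      have "\<bar>int a - int b\<bar> \<le> int (max a b)" by auto
      then have "\<bar>int a - int b\<bar> ^ 2 \<le> int (max a b) ^ 2" by (intro power_mono) auto
      also have "\<dots> < p" using that by (intro least) auto
      finally show ?thesis by simp
    qed
    show "(int i - int i') ^ 2 < p" "(int j - int j') ^ 2 < p" using sq ij by auto
    have "p dvd (int i - r * int j) - (int i' - r * int j')" using ij(6) by (simp only: mod_eq_dvd_iff)
    then show "p dvd (int i - int i') - r * (int j - int j')" by (simp add: algebra_simps)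
  qed
qed

text \<open>For \<open>u\<close> congruent to \<open>r * v\<close> as in Thue's lemma, the form is
  congruent to \<open>(r ^ 2 + d) * v ^ 2\<close>, hence to 0, and it lies strictly between 0 and
  \<open>(d + 1) * p\<close>.\<close>

lemma small_multiple_rep:
  fixes p r d :: int
  assumes p: "prime p" and d: "d \<ge> 1" and r: "p dvd r ^ 2 + d"
  obtains u v c where "u ^ 2 + d * v ^ 2 = c * p" "1 \<le> c" "c \<le> d"
proof -
  obtain u v where uv: "u \<noteq> 0 \<or> v \<noteq> 0" "u ^ 2 < p" "v ^ 2 < p" "p dvd u - r * v"
    using thue[OF p] by metis
  have p1: "p > 1" using p prime_gt_1_int by blast
  have "u ^ 2 + d * v ^ 2 = (u - r * v) * (u + r * v) + (r ^ 2 + d) * v ^ 2"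
    by (simp add: power2_eq_square algebra_simps)
  also have "p dvd \<dots>" by (intro dvd_add dvd_mult2 uv(4) r)
  finally obtain c where c: "u ^ 2 + d * v ^ 2 = p * c" by blast
  have "0 < u ^ 2 + d * v ^ 2"
    using uv(1) d by (cases "u = 0") (auto intro: add_pos_nonneg)
  then have "c > 0" unfolding c using p1 by (simp add: zero_less_mult_iff)
  have "d * v ^ 2 \<le> d * p" using uv d by (intro mult_left_mono) auto
  then have "p * c < p * (d + 1)" using uv(2) unfolding c[symmetric] by (simp add: algebra_simps)
  then have "c < d + 1" using p1 by simp
  show ?thesis by (rule that[of u v c]) (use c \<open>c > 0\<close> \<open>c < d + 1\<close> in \<open>auto simp: mult.commute\<close>)
qed

section \<open>Squares modulo 3, 5 and 8\<close>

lemma sq_mod_3: "(x::int) ^ 2 mod 3 = (if 3 dvd x then 0 else 1)"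
proof -
  have *: "x ^ 2 mod 3 = (x mod 3) ^ 2 mod 3" by (simp only: power_mod)
  show ?thesis unfolding * dvd_eq_mod_eq_0 using mod3_cases[of x] by (elim disjE) simp_all
qed

lemma sq_parity_cases: "(\<exists>k. (x::int) ^ 2 = 8 * k + 1 \<and> odd x) \<or> (\<exists>k. x ^ 2 = 4 * k \<and> even x)"
proof (cases "even x")
  case True
  then show ?thesis by (auto elim!: evenE simp: power2_eq_square)
next
  case False
  then obtain m where m: "x = 2 * m + 1" by (rule oddE)
  obtain k where k: "m * (m + 1) = 2 * k" using evenE[of "m * (m + 1)"] by auto
  have "x ^ 2 = 4 * (m * (m + 1)) + 1" by (simp add: m power2_eq_square algebra_simps)
  then have "x ^ 2 = 8 * k + 1" unfolding k by simp
  then show ?thesis using False by blast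
qed

lemma odd_square: "odd (x::int) \<Longrightarrow> \<exists>k. x ^ 2 = 8 * k + 1"
  using sq_parity_cases[of x] by blast

lemma sq_mod_5: "(x::int) ^ 2 mod 5 = 0 \<and> 5 dvd x \<or> x ^ 2 mod 5 = 1 \<or> x ^ 2 mod 5 = 4"
proof -
  have *: "x ^ 2 mod 5 = (x mod 5) ^ 2 mod 5" by (simp only: power_mod)
  have "x mod 5 \<in> {0, 1, 2, 3, 4}" unfolding insert_iff empty_iff by presburger
  then show ?thesis unfolding * dvd_eq_mod_eq_0 by (elim insertE emptyE) simp_all
qed

text \<open>-1 is not a square modulo 3.\<close>

lemma dvd_3_sum_squares:
  fixes u v :: int
  assumes "3 dvd u ^ 2 + v ^ 2"
  shows "3 dvd u \<and> 3 dvd v"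
proof -
  have "(u ^ 2 mod 3 + v ^ 2 mod 3) mod 3 = 0" using assms by (simp only: mod_add_eq dvd_eq_mod_eq_0)
  then show ?thesis by (simp add: sq_mod_3 split: if_splits)
qed

lemma dvd_3_sq_add_double_sq:
  fixes u v :: int
  assumes "(3 dvd u) = (3 dvd v)"
  shows "3 dvd u ^ 2 + 2 * v ^ 2"
proof -
  have "3 dvd u ^ 2 - v ^ 2" using assms by (simp add: sq_mod_3 flip: mod_eq_dvd_iff)
  then have "3 dvd (u ^ 2 - v ^ 2) + 3 * v ^ 2" by (intro dvd_add dvd_triv_left)
  then show ?thesis by (simp add: add.commute)
qed

lemma dvd_3_sum_squares_minus_1:
  fixes u v :: int
  assumes "(3 dvd u) \<noteq> (3 dvd v)"
  shows "3 dvd u ^ 2 + v ^ 2 - 1"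
proof -
  have "(u ^ 2 + v ^ 2) mod 3 = (u ^ 2 mod 3 + v ^ 2 mod 3) mod 3" by (simp only: mod_add_eq)
  also have "\<dots> = 1 mod 3" using assms by (auto simp: sq_mod_3)
  finally show ?thesis by (simp only: mod_eq_dvd_iff)
qed

text \<open>-2 is not a square modulo 5.\<close>

lemma dvd_5_sum_squares:
  fixes u v :: int
  assumes "5 dvd u ^ 2 + 2 * v ^ 2"
  shows "5 dvd u \<and> 5 dvd v"
proof -
  have "(u ^ 2 mod 5 + 2 * (v ^ 2 mod 5) mod 5) mod 5 = 0"
    using assms by (simp only: mod_add_eq mod_mult_right_eq dvd_eq_mod_eq_0)
  then show ?thesis using sq_mod_5[of u] sq_mod_5[of v] by (elim disjE conjE) simp_all
qed

text \<open>The multipliers \<open>c\<close> are treated in turn. For 1, 4 and 7 one keeps the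
  solution, halves it, or divides it by \<surd>-7. The value 2 would make \<open>p\<close> even, 3
  and 6 would force \<open>3 dvd p\<close>, and 5 would make -7 a square modulo 5.\<close>

lemma rep_7:
  fixes p r :: int
  assumes p: "prime p" "odd p" "p mod 3 = 2" and r: "p dvd r ^ 2 + 7"
  obtains u v where "p = u ^ 2 + 7 * v ^ 2"
proof -
  obtain u v c where uv: "u ^ 2 + 7 * v ^ 2 = c * p" "1 \<le> c" "c \<le> 7"
    using small_multiple_rep[OF p(1) _ r] by auto
  have m3: False if "u ^ 2 + 7 * v ^ 2 = 3 * k * p" "k = 1 \<or> k = 2" for k
  proof -
    have "u ^ 2 + v ^ 2 = 3 * (k * p - 2 * v ^ 2)" using that(1) by (simp add: algebra_simps)
    then have "3 dvd u \<and> 3 dvd v" by (intro dvd_3_sum_squares) (simp only: dvd_triv_left)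
    then obtain u' v' where "u = 3 * u'" "v = 3 * v'" by (auto elim!: dvdE)
    then have "3 * (u' ^ 2 + 7 * v' ^ 2) = k * p" using that by (simp add: power2_eq_square)
    then have "3 dvd k * p" by (metis dvd_triv_left)
    then have "3 dvd k \<or> 3 dvd p" by (rule prime_dvd_multD[rotated]) simp
    then show False using that(2) p(3) by (auto simp: dvd_eq_mod_eq_0)
  qed
  consider "c = 1" | "c = 2" | "c = 3" | "c = 4" | "c = 5" | "c = 6" | "c = 7" using uv by linarith
  then show ?thesis
  proof cases
    case 1 then show ?thesis using uv(1) that[of u v] by simp
  next
    case 2
    have par: "even u \<longleftrightarrow> even v" using arg_cong[OF uv(1)[unfolded 2], of even] by simp
    have "even p"
    proof (cases "even u")
      case True
      then obtain u' v' where "u = 2 * u'" "v = 2 * v'" using par by (auto elim!: evenE)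
      then have "p = 2 * (u' ^ 2 + 7 * v' ^ 2)" using uv(1) 2 by (simp add: power2_eq_square)
      then show ?thesis by simp
    next
      case False
      then obtain k l where "u ^ 2 = 8 * k + 1" "v ^ 2 = 8 * l + 1" using par odd_square by blast
      then have "p = 2 * (2 * (k + 7 * l + 1))" using uv(1) 2 by simp
      then show ?thesis by simp
    qed
    then show ?thesis using p(2) by blast
  next
    case 3 then show ?thesis using uv(1) m3[of 1] by simp
  next
    case 4
    have par: "even u \<longleftrightarrow> even v" using arg_cong[OF uv(1)[unfolded 4], of even] by simp
    have "even u"
    proof (rule ccontr)
      assume "odd u"
      then obtain k l where "u ^ 2 = 8 * k + 1" "v ^ 2 = 8 * l + 1" using par odd_square by blast
      then have "p = 2 * (k + 7 * l + 1)" using uv(1) 4 by simp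
      then show False using p(2) by simp
    qed
    then have "even u \<and> even v" using par by simp
    then obtain u' v' where "u = 2 * u'" "v = 2 * v'" by (auto elim!: evenE)
    then have "p = u' ^ 2 + 7 * v' ^ 2" using uv(1) 4 by (simp add: power2_eq_square)
    then show ?thesis by (rule that)
  next
    case 5
    have "u ^ 2 + 2 * v ^ 2 = 5 * (p - v ^ 2)" using uv(1)[unfolded 5] by simp
    then have "5 dvd u \<and> 5 dvd v" by (intro dvd_5_sum_squares) (simp only: dvd_triv_left)
    then obtain u' v' where "u = 5 * u'" "v = 5 * v'" by (auto elim!: dvdE)
    then have "p = 5 * (u' ^ 2 + 7 * v' ^ 2)" using uv(1) 5 by (simp add: power2_eq_square)
    then have "5 dvd p" by simp
    then have "5 dvd r ^ 2 + 7" using r dvd_trans by blast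
    then have False using sq_mod_5[of r] by presburger
    then show ?thesis ..
  next
    case 6 then show ?thesis using uv(1) m3[of 2] by simp
  next
    case 7
    have "7 dvd u ^ 2" using uv(1)[unfolded 7] by presburger
    then have "7 dvd u" using prime_dvd_power[of 7 u 2] by simp
    then obtain u' where "u = 7 * u'" by blast
    then have "p = v ^ 2 + 7 * u' ^ 2" using uv(1) 7 by (simp add: power2_eq_square)
    then show ?thesis by (rule that)
  qed
qed

text \<open>There are two classes of forms of discriminant -20. A prime that is 3 modulo 4 is not of
  the form \<open>u ^ 2 + 5 * v ^ 2\<close>, which excludes the multipliers 1, 4 and 5; the
  multiplier 3 is turned into 2.\<close>

lemma rep_5:
  fixes p r :: int
  assumes p: "prime p" "p mod 4 = 3" "p \<noteq> 3" and r: "p dvd r ^ 2 + 5"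
  obtains u v where "2 * p = u ^ 2 + 5 * v ^ 2"
proof -
  obtain u v c where uv: "u ^ 2 + 5 * v ^ 2 = c * p" "1 \<le> c" "c \<le> 5"
    using small_multiple_rep[OF p(1) _ r] by auto
  have no: False if "p = u ^ 2 + 5 * v ^ 2" for u v
    using sq_parity_cases[of u] sq_parity_cases[of v] that p(2) by (elim disjE exE conjE) presburger+
  consider "c = 1" | "c = 2" | "c = 3" | "c = 4" | "c = 5" using uv by linarith
  then show ?thesis
  proof cases
    case 1 then show ?thesis using uv no[of u v] by simp
  next
    case 2 then show ?thesis using uv(1) that[of u v] by simp
  next
    case 3
    \<comment> \<open>The witness is \<open>u + v \<surd>-5\<close> times
      \<open>(1 - \<surd>-5) / 3\<close>, an element of norm 2/3; the product is integral if
      \<open>3 dvd v - u\<close>, which holds after a suitable choice of the sign of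
      \<open>v\<close>.\<close>
    have *: "\<exists>u v. 2 * p = u ^ 2 + 5 * v ^ 2" if uv: "u ^ 2 + 5 * v ^ 2 = 3 * p" and dv: "3 dvd v - u" for u v
    proof -
      obtain t where t: "v = u + 3 * t" using dv by (auto elim!: dvdE simp: algebra_simps)
      have "9 * ((2 * u + 5 * t) ^ 2 + 5 * t ^ 2) = 6 * (u ^ 2 + 5 * v ^ 2)"
        unfolding t by (simp add: power2_eq_square algebra_simps)
      then have "2 * p = (2 * u + 5 * t) ^ 2 + 5 * t ^ 2" using uv by simp
      then show ?thesis by blast
    qed
    have "(v - u) * (- v - u) = 3 * (p - 2 * v ^ 2)"
      using uv(1)[unfolded 3] by (simp add: power2_eq_square algebra_simps)
    then have "3 dvd (v - u) * (- v - u)" by simp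
    then have "3 dvd v - u \<or> 3 dvd - v - u" by (rule prime_dvd_multD[rotated]) simp
    then have "\<exists>u v. 2 * p = u ^ 2 + 5 * v ^ 2"
      using *[of u v] *[of u "- v"] uv(1)[unfolded 3] by auto
    then show ?thesis using that by blast
  next
    case 4
    have par: "even u \<longleftrightarrow> even v" using arg_cong[OF uv(1)[unfolded 4], of even] by simp
    have "even u"
    proof (rule ccontr)
      assume "odd u"
      then obtain k l where "u ^ 2 = 8 * k + 1" "v ^ 2 = 8 * l + 1" using par odd_square by blast
      then have "2 * (2 * (p - 2 * k - 10 * l)) = 2 * 3" using uv(1) 4 by simp
      then have "even (3 :: int)" by (metis dvd_triv_left mult_cancel_left zero_neq_numeral)
      then show False by simp
    qed
    then have "even u \<and> even v" using par by simp
    then obtain u' v' where "u = 2 * u'" "v = 2 * v'" by (auto elim!: evenE)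
    then have "p = u' ^ 2 + 5 * v' ^ 2" using uv(1) 4 by (simp add: power2_eq_square)
    then show ?thesis using no by blast
  next
    case 5
    have "5 dvd u ^ 2" using uv(1)[unfolded 5] by presburger
    then have "5 dvd u" using prime_dvd_power[of 5 u 2] by simp
    then obtain u' where "u = 5 * u'" by blast
    then have "p = v ^ 2 + 5 * u' ^ 2" using uv(1) 5 by (simp add: power2_eq_square)
    then show ?thesis using no by blast
  qed
qed

text \<open>The multiplier is 1 or 2; in the second case \<open>u\<close> is even and division by
  \<surd>-2 exchanges the two coordinates.\<close>

lemma rep_2:
  fixes p r :: int
  assumes p: "prime p" "odd p" and r: "p dvd r ^ 2 + 2"
  obtains u v where "p = u ^ 2 + 2 * v ^ 2"
proof -
  obtain u v c where uv: "u ^ 2 + 2 * v ^ 2 = c * p" "1 \<le> c" "c \<le> 2"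
    using small_multiple_rep[OF p(1) _ r] by auto
  consider "c = 1" | "c = 2" using uv by linarith
  then show ?thesis
  proof cases
    case 1 then show ?thesis using uv(1) that[of u v] by simp
  next
    case 2
    have "u ^ 2 = 2 * (p - v ^ 2)" using uv(1)[unfolded 2] by simp
    then have "even (u ^ 2)" by simp
    then obtain u' where "u = 2 * u'" by auto
    then have "p = v ^ 2 + 2 * u' ^ 2" using uv(1) 2 by (simp add: power2_eq_square)
    then show ?thesis by (rule that)
  qed
qed

section \<open>The ramified primes\<close>

text \<open>
  Every solution \<open>x + y \<surd>-d\<close> of norm \<open>q M\<close> that contributes is, after changing the sign of \<open>y\<close> if
  necessary, the product of a solution of norm \<open>M\<close> with \<open>(g + h \<surd>-d) / c\<close>, an element of norm \<open>q\<close>.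
\<close>

lemma theta_scale:
  fixes d q c g h M :: int
  defines "C \<equiv> \<lambda>x y. c * q dvd g * x + d * h * y \<and> c * q dvd g * y - h * x"
  defines "f \<equiv> \<lambda>s t. if c dvd g * s - d * h * t \<and> c dvd h * s + g * t
    then chi ((g * s - d * h * t) div c) * chi ((h * s + g * t) div c) else 0"
  assumes d: "d \<ge> 1" and c: "c \<noteq> 0" and q: "q \<noteq> 0" and gh: "g ^ 2 + d * h ^ 2 = c ^ 2 * q"
    and f: "\<And>s t. f s t + f s (- t) = - (chi s * chi t)"
    and C: "\<And>x y. x ^ 2 + d * y ^ 2 = q * M \<Longrightarrow> chi x \<noteq> 0 \<Longrightarrow> chi y \<noteq> 0 \<Longrightarrow> C x y \<noteq> C x (- y)"
  shows "theta d (q * M) = - theta d M"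
proof -
  \<comment> \<open>\<open>C x y\<close> says that \<open>x + y \<surd>-d\<close> divided by
    \<open>(g + h \<surd>-d) / c\<close> has integral coordinates, and \<open>f s t\<close> is the
    summand at the product of \<open>s + t \<surd>-d\<close> with that element, or 0 if the product
    is not integral.\<close>
  let ?W = "\<lambda>x y. if C x y then chi x * chi y else 0"
  let ?R = "reps d (q * M)"
  define D where "D = {(s, t) \<in> reps d M. c dvd g * s - d * h * t \<and> c dvd h * s + g * t}"
  have fin: "finite ?R" "finite (reps d M)" using d by (simp_all add: finite_reps)
  have split: "(\<Sum>(x, y)\<in>?R. F x y) = (\<Sum>(x, y)\<in>?R. F x (- y))" for F :: "int \<Rightarrow> int \<Rightarrow> int"
    by (rule sum.reindex_bij_witness[where i = "\<lambda>(x, y). (x, - y)" and j = "\<lambda>(x, y). (x, - y)"])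
      (auto simp: reps_def)
  have split': "(\<Sum>(x, y)\<in>reps d M. F x y) = (\<Sum>(x, y)\<in>reps d M. F x (- y))" for F :: "int \<Rightarrow> int \<Rightarrow> int"
    by (rule sum.reindex_bij_witness[where i = "\<lambda>(x, y). (x, - y)" and j = "\<lambda>(x, y). (x, - y)"])
      (auto simp: reps_def)
  \<comment> \<open>Among \<open>(x, y)\<close> and \<open>(x, - y)\<close> exactly one satisfies
    \<open>C\<close> if the summand is nonzero, and both have the same summand.\<close>
  have "theta d (q * M) = (\<Sum>(x, y)\<in>?R. ?W x y + ?W x (- y))"
    unfolding theta_def
  proof (rule sum.cong)
    fix z assume "z \<in> ?R"
    then obtain x y where z: "z = (x, y)" "x ^ 2 + d * y ^ 2 = q * M" by (auto simp: reps_def)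
    then show "(case z of (x, y) \<Rightarrow> chi x * chi y) = (case z of (x, y) \<Rightarrow> ?W x y + ?W x (- y))"
      using C[of x y] by (cases "chi x = 0 \<or> chi y = 0") auto
  qed simp
  also have "\<dots> = 2 * (\<Sum>(x, y)\<in>?R. ?W x y)"
    using split[of ?W] by (simp add: case_prod_unfold sum.distrib)
  also have "(\<Sum>(x, y)\<in>?R. ?W x y) = (\<Sum>(x, y)\<in>{(x, y) \<in> ?R. C x y}. chi x * chi y)"
    unfolding case_prod_unfold
    by (subst sum.inter_filter[OF fin(1), symmetric]) (auto intro!: sum.cong)
  also have "\<dots> = (\<Sum>(s, t)\<in>D. f s t)"
  \<comment> \<open>\<open>?j\<close> divides by \<open>(g + h \<surd>-d) / c\<close> and
    \<open>?i\<close> multiplies by it.\<close>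
  proof (rule sum.reindex_bij_witness)
    let ?i = "\<lambda>(s, t). ((g * s - d * h * t) div c, (h * s + g * t) div c)"
    let ?j = "\<lambda>(x, y). ((g * x + d * h * y) div (c * q), (g * y - h * x) div (c * q))"
    fix z assume "z \<in> {(x, y) \<in> ?R. C x y}"
    then obtain x y where z: "z = (x, y)" "x ^ 2 + d * y ^ 2 = q * M" "C x y" by (auto simp: reps_def)
    then obtain s t where s: "g * x + d * h * y = c * q * s" and t: "g * y - h * x = c * q * t"
      unfolding C_def by (meson dvdE)
    have j: "?j z = (s, t)" using c q by (simp add: z s t)
    have "c * q * (g * s - d * h * t) = g * (c * q * s) - d * h * (c * q * t)" by (simp add: algebra_simps)
    also have "\<dots> = (g ^ 2 + d * h ^ 2) * x"
      unfolding s[symmetric] t[symmetric] by (simp add: power2_eq_square algebra_simps)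
    also have "\<dots> = c * q * (c * x)" unfolding gh by (simp add: power2_eq_square)
    finally have x: "g * s - d * h * t = c * x" using c q by simp
    have "c * q * (h * s + g * t) = h * (c * q * s) + g * (c * q * t)" by (simp add: algebra_simps)
    also have "\<dots> = (g ^ 2 + d * h ^ 2) * y"
      unfolding s[symmetric] t[symmetric] by (simp add: power2_eq_square algebra_simps)
    also have "\<dots> = c * q * (c * y)" unfolding gh by (simp add: power2_eq_square)
    finally have y: "h * s + g * t = c * y" using c q by simp
    have "(c * q) ^ 2 * (s ^ 2 + d * t ^ 2) = (c * q * s) ^ 2 + d * (c * q * t) ^ 2"
      by (simp add: power2_eq_square algebra_simps)
    also have "\<dots> = (g ^ 2 + d * h ^ 2) * (x ^ 2 + d * y ^ 2)"
      unfolding s[symmetric] t[symmetric] by (simp add: power2_eq_square algebra_simps)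
    also have "\<dots> = (c * q) ^ 2 * M" unfolding gh z(2) by (simp add: power2_eq_square)
    finally have "s ^ 2 + d * t ^ 2 = M" using c q by simp
    then show "?j z \<in> D" unfolding j D_def reps_def using x y by simp
    show "?i (?j z) = z" unfolding j using c by (simp add: z x y)
    show "(case ?j z of (s, t) \<Rightarrow> f s t) = (case z of (x, y) \<Rightarrow> chi x * chi y)"
      unfolding j using c by (simp add: z f_def x y)
  next
    let ?i = "\<lambda>(s, t). ((g * s - d * h * t) div c, (h * s + g * t) div c)"
    let ?j = "\<lambda>(x, y). ((g * x + d * h * y) div (c * q), (g * y - h * x) div (c * q))"
    fix z assume "z \<in> D"
    then obtain s t where z: "z = (s, t)" "s ^ 2 + d * t ^ 2 = M"
      "c dvd g * s - d * h * t" "c dvd h * s + g * t" by (auto simp: D_def reps_def)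
    then obtain x y where x: "g * s - d * h * t = c * x" and y: "h * s + g * t = c * y"
      by (meson dvdE)
    have i: "?i z = (x, y)" using c by (simp add: z x y)
    have "c * (g * x + d * h * y) = g * (c * x) + d * h * (c * y)" by (simp add: algebra_simps)
    also have "\<dots> = (g ^ 2 + d * h ^ 2) * s"
      unfolding x[symmetric] y[symmetric] by (simp add: power2_eq_square algebra_simps)
    also have "\<dots> = c * (c * q * s)" unfolding gh by (simp add: power2_eq_square)
    finally have s: "g * x + d * h * y = c * q * s" using c by simp
    have "c * (g * y - h * x) = g * (c * y) - h * (c * x)" by (simp add: algebra_simps)
    also have "\<dots> = (g ^ 2 + d * h ^ 2) * t"
      unfolding x[symmetric] y[symmetric] by (simp add: power2_eq_square algebra_simps)
    also have "\<dots> = c * (c * q * t)" unfolding gh by (simp add: power2_eq_square)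
    finally have t: "g * y - h * x = c * q * t" using c by simp
    have "c ^ 2 * (x ^ 2 + d * y ^ 2) = (c * x) ^ 2 + d * (c * y) ^ 2"
      by (simp add: power2_eq_square algebra_simps)
    also have "\<dots> = (g ^ 2 + d * h ^ 2) * (s ^ 2 + d * t ^ 2)"
      unfolding x[symmetric] y[symmetric] by (simp add: power2_eq_square algebra_simps)
    also have "\<dots> = c ^ 2 * (q * M)" unfolding gh z(2) by (simp add: power2_eq_square)
    finally have "x ^ 2 + d * y ^ 2 = q * M" using c by simp
    then show "?i z \<in> {(x, y) \<in> ?R. C x y}" unfolding i C_def reps_def using s t by simp
    show "?j (?i z) = z" unfolding i using c q by (simp add: z s t)
  qed
  also have "\<dots> = (\<Sum>(s, t)\<in>reps d M. f s t)"
    by (rule sum.mono_neutral_left) (use fin(2) in \<open>auto simp: D_def f_def split: if_splits\<close>)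
  \<comment> \<open>Pairing \<open>t\<close> with \<open>- t\<close> brings in the hypothesis on
    \<open>f\<close>.\<close>
  also have "2 * \<dots> = (\<Sum>(s, t)\<in>reps d M. f s t + f s (- t))"
    using split'[of f] by (simp add: case_prod_unfold sum.distrib)
  also have "\<dots> = - theta d M" unfolding f theta_def by (simp add: case_prod_unfold sum_negf)
  finally show ?thesis .
qed

lemma chi4_mod: "chi4 (x mod 4) = chi4 x" by (simp add: chi4_def)

lemma chi3_mod: "chi3 (x mod 3) = chi3 x" by (simp add: chi3_def)

text \<open>If 3 divides neither \<open>s\<close> nor \<open>t\<close>, it divides exactly one of
  \<open>s + t\<close> and \<open>s - t\<close>, according to the value of
  \<open>chi3 s * chi3 t\<close>; otherwise the squares agree. This merges the two signs of
  \<open>t\<close> in \<open>theta_scale\<close> at the prime 3.\<close>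

lemma chi3_sq_diff: "chi3 (s + t) ^ 2 - chi3 (s - t) ^ 2 = chi3 s * chi3 t"
proof -
  have *: "chi3 (a + b) ^ 2 - chi3 (a - b) ^ 2 = chi3 a * chi3 b" if "a \<in> {0, 1, 2}" "b \<in> {0, 1, 2}" for a b
    using that by (elim insertE emptyE) (simp_all add: chi3_def)
  have "chi3 (s + t) = chi3 (s mod 3 + t mod 3)" "chi3 (s - t) = chi3 (s mod 3 - t mod 3)"
    by (rule chi3_cong, simp only: mod_add_eq mod_diff_eq)+
  then show ?thesis using *[OF mod3_mem mod3_mem, of s t] by (simp only: chi3_mod)
qed

text \<open>\<open>-2 + \<surd>-5\<close> has norm 9 and generates the square of a prime ideal above
  3. The minus sign comes from \<open>chi4\<close>.\<close>

lemma theta_5_scale: "theta 5 (9 * M) = - theta 5 M"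
proof (rule theta_scale[where c = 1 and g = "-2" and h = 1])
  fix s t :: int
  have 4: "chi4 (-2 * s - 5 * t) * chi4 (s - 2 * t) = - (chi4 s * chi4 t)" for s t
  proof -
    have *: "chi4 (-2 * a - 5 * b) * chi4 (a - 2 * b) = - (chi4 a * chi4 b)"
      if "a \<in> {0, 1, 2, 3}" "b \<in> {0, 1, 2, 3}" for a b
      using that by (elim insertE emptyE) (simp_all add: chi4_def)
    have "chi4 (-2 * s - 5 * t) = chi4 (-2 * (s mod 4) - 5 * (t mod 4))"
      "chi4 (s - 2 * t) = chi4 (s mod 4 - 2 * (t mod 4))"
      by (rule chi4_cong, unfold cong_def[symmetric],
          intro cong_add cong_diff cong_mult cong_minus_minus_iff[THEN iffD2]; simp add: cong_def)+
    then show ?thesis using *[OF mod4_mem mod4_mem, of s t] by (simp only: chi4_mod)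
  qed
  have 3: "chi3 (-2 * s - 5 * t) = chi3 (s + t)" "chi3 (s - 2 * t) = chi3 (s + t)" for s t
    by (rule chi3_eqI[where k = "- s - 2 * t"] chi3_eqI[where k = "- t"], simp)+
  have "chi (-2 * s - 5 * t) * chi (s - 2 * t) = - (chi4 s * chi4 t) * chi3 (s + t) ^ 2" for s t
    unfolding chi_def 3 4[symmetric] by (simp add: power2_eq_square)
  from this[of s t] this[of s "- t"] chi3_sq_diff[of s t]
  have "chi (-2 * s - 5 * t) * chi (s - 2 * t) + chi (-2 * s - 5 * (- t)) * chi (s - 2 * (- t)) =
    - (chi4 s * chi4 t) * (chi3 s * chi3 t)"
    by (simp add: algebra_simps flip: chi3_sq_diff)
  then show "(if 1 dvd - 2 * s - 5 * 1 * t \<and> 1 dvd 1 * s + - 2 * t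
    then chi ((- 2 * s - 5 * 1 * t) div 1) * chi ((1 * s + - 2 * t) div 1) else 0) +
    (if 1 dvd - 2 * s - 5 * 1 * (- t) \<and> 1 dvd 1 * s + - 2 * (- t)
    then chi ((- 2 * s - 5 * 1 * (- t)) div 1) * chi ((1 * s + - 2 * (- t)) div 1) else 0) = - (chi s * chi t)"
    by (simp add: chi_def)
next
  fix x y :: int
  assume xy: "x ^ 2 + 5 * y ^ 2 = 9 * M" and "chi x \<noteq> 0" "chi y \<noteq> 0"
  then have n3: "\<not> 3 dvd x" "\<not> 3 dvd y" by (auto simp: chi_eq_0_iff)
  \<comment> \<open>Divisibility by the generator amounts to \<open>9 dvd x + 2 * y\<close>. The
    product of the two conjugate conditions is divisible by 9, and 3 cannot divide both factors, as
    their sum is \<open>2 * x\<close>.\<close>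
  have "(x + 2 * y) * (x - 2 * y) = 9 * (M - y ^ 2)"
    using xy by (simp add: power2_eq_square algebra_simps)
  then have d: "9 dvd (x + 2 * y) * (x - 2 * y)" by simp
  have cop: "coprime 9 z" if "\<not> 3 dvd z" for z :: int
    using that prime_imp_coprime[of 3 z] coprime_power_left_iff[of 3 2 z] by simp
  have "9 dvd x + 2 * y \<or> 9 dvd x - 2 * y"
  proof (cases "3 dvd x + 2 * y")
    case True
    then have "\<not> 3 dvd x - 2 * y" using n3 by presburger
    then show ?thesis using d cop coprime_dvd_mult_left_iff by blast
  next
    case False
    then show ?thesis using d cop coprime_dvd_mult_right_iff by blast
  qed
  moreover have "\<not> (9 dvd x + 2 * y \<and> 9 dvd x - 2 * y)"
  proof
    assume "9 dvd x + 2 * y \<and> 9 dvd x - 2 * y"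
    then have "9 dvd (x + 2 * y) + (x - 2 * y)" by (blast intro: dvd_add)
    then have "3 dvd 2 * x" using dvd_trans[of 3 9 "2 * x"] by simp
    then show False using n3 by (simp add: prime_dvd_mult_iff)
  qed
  moreover have C: "1 * 9 dvd - 2 * x + 5 * 1 * z \<and> 1 * 9 dvd - 2 * z - 1 * x \<longleftrightarrow> 9 dvd x + 2 * z" for z
  proof -
    have *: "- 2 * z - x = - (x + 2 * z)" "- 2 * x + 5 * z = 9 * z - 2 * (x + 2 * z)" by simp_all
    show ?thesis unfolding mult_1 mult_1_right unfolding * dvd_minus_iff
      by (blast intro: dvd_diff dvd_mult dvd_triv_left)
  qed
  ultimately show "(1 * 9 dvd - 2 * x + 5 * 1 * y \<and> 1 * 9 dvd - 2 * y - 1 * x) \<noteq>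
    (1 * 9 dvd - 2 * x + 5 * 1 * - y \<and> 1 * 9 dvd - 2 * - y - 1 * x)"
    unfolding C by auto
qed auto

text \<open>The element of norm 9 is now \<open>-1 + 2 \<surd>-2\<close>, the square of
  \<open>1 + \<surd>-2\<close>, and divisibility by it amounts to
  \<open>9 dvd x - 4 * y\<close>.\<close>

lemma theta_2_scale: "theta 2 (9 * M) = - theta 2 M"
proof (rule theta_scale[where c = 1 and g = "-1" and h = 2])
  fix s t :: int
  have 4: "chi4 (- s - 4 * t) * chi4 (2 * s - t) = - (chi4 s * chi4 t)" for s t
  proof -
    have *: "chi4 (- a - 4 * b) * chi4 (2 * a - b) = - (chi4 a * chi4 b)"
      if "a \<in> {0, 1, 2, 3}" "b \<in> {0, 1, 2, 3}" for a b
      using that by (elim insertE emptyE) (simp_all add: chi4_def)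
    have "chi4 (- s - 4 * t) = chi4 (- (s mod 4) - 4 * (t mod 4))"
      "chi4 (2 * s - t) = chi4 (2 * (s mod 4) - (t mod 4))"
      by (rule chi4_cong, unfold cong_def[symmetric],
          intro cong_add cong_diff cong_mult cong_minus_minus_iff[THEN iffD2]; simp add: cong_def)+
    then show ?thesis using *[OF mod4_mem mod4_mem, of s t] by (simp only: chi4_mod)
  qed
  have 3: "chi3 (- s - 4 * t) = - chi3 (s + t)" "chi3 (2 * s - t) = - chi3 (s + t)" for s t
    unfolding chi3_minus[symmetric] by (rule chi3_eqI[where k = "- t"] chi3_eqI[where k = s], simp)+
  have "chi (- s - 4 * t) * chi (2 * s - t) = - (chi4 s * chi4 t) * chi3 (s + t) ^ 2" for s t
    unfolding chi_def 3 4[symmetric] by (simp add: power2_eq_square)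
  from this[of s t] this[of s "- t"] chi3_sq_diff[of s t]
  have "chi (- s - 4 * t) * chi (2 * s - t) + chi (- s - 4 * (- t)) * chi (2 * s - (- t)) =
    - (chi4 s * chi4 t) * (chi3 s * chi3 t)"
    by (simp add: algebra_simps flip: chi3_sq_diff)
  then show "(if 1 dvd - 1 * s - 2 * 2 * t \<and> 1 dvd 2 * s + - 1 * t
    then chi ((- 1 * s - 2 * 2 * t) div 1) * chi ((2 * s + - 1 * t) div 1) else 0) +
    (if 1 dvd - 1 * s - 2 * 2 * (- t) \<and> 1 dvd 2 * s + - 1 * (- t)
    then chi ((- 1 * s - 2 * 2 * (- t)) div 1) * chi ((2 * s + - 1 * (- t)) div 1) else 0) = - (chi s * chi t)"
    by (simp add: chi_def)
next
  fix x y :: int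
  assume xy: "x ^ 2 + 2 * y ^ 2 = 9 * M" and "chi x \<noteq> 0" "chi y \<noteq> 0"
  then have n3: "\<not> 3 dvd x" "\<not> 3 dvd y" by (auto simp: chi_eq_0_iff)
  have "(x + 4 * y) * (x - 4 * y) = 9 * (M - 2 * y ^ 2)"
    using xy by (simp add: power2_eq_square algebra_simps)
  then have d: "9 dvd (x + 4 * y) * (x - 4 * y)" by simp
  have cop: "coprime 9 z" if "\<not> 3 dvd z" for z :: int
    using that prime_imp_coprime[of 3 z] coprime_power_left_iff[of 3 2 z] by simp
  have "9 dvd x + 4 * y \<or> 9 dvd x - 4 * y"
  proof (cases "3 dvd x + 4 * y")
    case True
    then have "\<not> 3 dvd x - 4 * y" using n3 by presburger
    then show ?thesis using d cop coprime_dvd_mult_left_iff by blast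
  next
    case False
    then show ?thesis using d cop coprime_dvd_mult_right_iff by blast
  qed
  moreover have "\<not> (9 dvd x + 4 * y \<and> 9 dvd x - 4 * y)"
  proof
    assume "9 dvd x + 4 * y \<and> 9 dvd x - 4 * y"
    then have "9 dvd (x + 4 * y) + (x - 4 * y)" by (blast intro: dvd_add)
    then have "3 dvd 2 * x" using dvd_trans[of 3 9 "2 * x"] by simp
    then show False using n3 by (simp add: prime_dvd_mult_iff)
  qed
  moreover have C: "1 * 9 dvd - 1 * x + 2 * 2 * z \<and> 1 * 9 dvd - 1 * z - 2 * x \<longleftrightarrow> 9 dvd x - 4 * z" for z
  proof -
    have *: "- 1 * x + 2 * 2 * z = - (x - 4 * z)" "- 1 * z - 2 * x = 9 * (- z) - 2 * (x - 4 * z)" by simp_all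
    show ?thesis unfolding mult_1 mult_1_right unfolding * dvd_minus_iff
      by (blast intro: dvd_diff dvd_mult dvd_triv_left)
  qed
  ultimately show "(1 * 9 dvd - 1 * x + 2 * 2 * y \<and> 1 * 9 dvd - 1 * y - 2 * x) \<noteq>
    (1 * 9 dvd - 1 * x + 2 * 2 * - y \<and> 1 * 9 dvd - 1 * - y - 2 * x)"
    unfolding C by auto
qed auto

text \<open>\<open>(-3 + \<surd>-7) / 2\<close> is the square of \<open>(1 + \<surd>-7) / 2\<close>
  and has norm 4. The second factor 4 makes \<open>x ^ 2 - 9 * y ^ 2\<close> divisible by 16; as the
  halves of \<open>x - 3 * y\<close> and \<open>x + 3 * y\<close> have the odd sum \<open>x\<close>,
  exactly one of them is divisible by 4.\<close>

lemma theta_7_scale: "theta 7 (4 * (4 * M)) = - theta 7 (4 * M)"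
proof (rule theta_scale[where c = 2 and g = "-3" and h = 1])
  fix s t :: int
  show "(if 2 dvd - 3 * s - 7 * 1 * t \<and> 2 dvd 1 * s + - 3 * t
    then chi ((- 3 * s - 7 * 1 * t) div 2) * chi ((1 * s + - 3 * t) div 2) else 0) +
    (if 2 dvd - 3 * s - 7 * 1 * (- t) \<and> 2 dvd 1 * s + - 3 * (- t)
    then chi ((- 3 * s - 7 * 1 * (- t)) div 2) * chi ((1 * s + - 3 * (- t)) div 2) else 0) = - (chi s * chi t)"
  \<comment> \<open>For different parities both products fail to be integral and
    \<open>chi s * chi t = 0\<close>; for equal parities both are integral.\<close>
  proof (cases "even s \<longleftrightarrow> even t")
    case False
    then have "chi s * chi t = 0" by (auto simp: chi_eq_0_iff)
    then show ?thesis using False by auto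
  next
    case True
    then have "2 dvd s - 3 * t" by simp
    then obtain y where "s - 3 * t = 2 * y" by blast
    then have s: "s = 3 * t + 2 * y" by simp
    have e: "- 3 * s - 7 * 1 * t = 2 * (- 8 * t - 3 * y)" "1 * s + - 3 * t = 2 * y"
      "- 3 * s - 7 * 1 * (- t) = 2 * (- t - 3 * y)" "1 * s + - 3 * (- t) = 2 * (3 * t + y)"
      by (simp_all add: s)
    have 4: "chi4 (- 8 * t - 3 * y) * chi4 y - chi4 (- t - 3 * y) * chi4 (3 * t + y) = chi4 (3 * t + 2 * y) * chi4 t"
    proof -
      have *: "chi4 (- 8 * a - 3 * b) * chi4 b - chi4 (- a - 3 * b) * chi4 (3 * a + b) = chi4 (3 * a + 2 * b) * chi4 a"
        if "a \<in> {0, 1, 2, 3}" "b \<in> {0, 1, 2, 3}" for a b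
        using that by (elim insertE emptyE) (simp_all add: chi4_def)
      have "chi4 (- 8 * t - 3 * y) = chi4 (- 8 * (t mod 4) - 3 * (y mod 4))"
        "chi4 (- t - 3 * y) = chi4 (- (t mod 4) - 3 * (y mod 4))"
        "chi4 (3 * t + y) = chi4 (3 * (t mod 4) + y mod 4)"
        "chi4 (3 * t + 2 * y) = chi4 (3 * (t mod 4) + 2 * (y mod 4))"
        by (rule chi4_cong, unfold cong_def[symmetric],
          intro cong_add cong_diff cong_mult cong_minus_minus_iff[THEN iffD2]; simp add: cong_def)+
      then show ?thesis using *[OF mod4_mem mod4_mem, of t y] by (simp only: chi4_mod)
    qed
    have 3: "chi3 (- 8 * t - 3 * y) = chi3 t" "chi3 (- t - 3 * y) = - chi3 t"
      "chi3 (3 * t + y) = chi3 y" "chi3 (3 * t + 2 * y) = - chi3 y"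
      unfolding chi3_minus[symmetric]
      by (rule chi3_eqI[where k = "- 3 * t - y"] chi3_eqI[where k = "- y"] chi3_eqI[where k = t]
        chi3_eqI[where k = "t + y"], simp)+
    have "chi (- 8 * t - 3 * y) * chi y + chi (- t - 3 * y) * chi (3 * t + y) =
      chi3 t * chi3 y * (chi4 (- 8 * t - 3 * y) * chi4 y - chi4 (- t - 3 * y) * chi4 (3 * t + y))"
      unfolding chi_def 3 by (simp add: algebra_simps)
    also have "\<dots> = - (chi s * chi t)" unfolding 4 s chi_def 3 by (simp add: algebra_simps)
    finally have "chi (- 8 * t - 3 * y) * chi y + chi (- t - 3 * y) * chi (3 * t + y) = - (chi s * chi t)" .
    moreover have "2 * z div 2 = z" for z :: int by simp
    ultimately show ?thesis unfolding e by (simp only: dvd_triv_left simp_thms if_True)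
  qed
next
  fix x y :: int
  assume xy: "x ^ 2 + 7 * y ^ 2 = 4 * (4 * M)" and "chi x \<noteq> 0" "chi y \<noteq> 0"
  then have odd: "odd x" "odd y" by (auto simp: chi_eq_0_iff)
  have "(x - 3 * y) * (x + 3 * y) = 16 * (M - y ^ 2)"
    using xy by (simp add: power2_eq_square algebra_simps)
  moreover have "even (x - 3 * y)" "even (x + 3 * y)" using odd by auto
  then obtain A B where A: "x - 3 * y = 2 * A" and B: "x + 3 * y = 2 * B" by (meson evenE)
  ultimately have "4 * (A * B) = 4 * (4 * (M - y ^ 2))" by (simp add: A B ac_simps)
  then have "A * B = 4 * (M - y ^ 2)" by simp
  then have AB: "4 dvd A * B" by simp
  have "A + B = x" using A B by simp
  then have par: "odd A \<longleftrightarrow> even B" using odd by auto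
  have cop: "coprime 4 z" if "odd z" for z :: int
    using that coprime_power_left_iff[of 2 2 z] by simp
  have "4 dvd A \<or> 4 dvd B"
  proof (cases "odd A")
    case True
    then show ?thesis using AB cop coprime_dvd_mult_right_iff by blast
  next
    case False
    then show ?thesis using AB cop par coprime_dvd_mult_left_iff by blast
  qed
  moreover have "8 dvd x + 3 * y \<longleftrightarrow> 4 dvd B" "8 dvd x - 3 * y \<longleftrightarrow> 4 dvd A"
    unfolding A B by auto
  moreover have "\<not> (4 dvd A \<and> 4 dvd B)" using par by presburger
  ultimately have "(8 dvd x + 3 * y) \<noteq> (8 dvd x - 3 * y)" by blast
  moreover have C: "2 * 4 dvd - 3 * x + 7 * 1 * z \<and> 2 * 4 dvd - 3 * z - 1 * x \<longleftrightarrow> 8 dvd x + 3 * z" for z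
  proof -
    have *: "- 3 * z - x = - (x + 3 * z)" "- 3 * x + 7 * z = 8 * (2 * z) - 3 * (x + 3 * z)"
      "2 * 4 = (8 :: int)" by simp_all
    show ?thesis unfolding mult_1 mult_1_right unfolding * dvd_minus_iff
      by (blast intro: dvd_diff dvd_mult dvd_triv_left)
  qed
  ultimately show "(2 * 4 dvd - 3 * x + 7 * 1 * y \<and> 2 * 4 dvd - 3 * y - 1 * x) \<noteq>
    (2 * 4 dvd - 3 * x + 7 * 1 * - y \<and> 2 * 4 dvd - 3 * - y - 1 * x)" unfolding C by simp
qed auto

lemma theta_eq_0I:
  assumes "\<And>x y. x ^ 2 + d * y ^ 2 = M \<Longrightarrow> chi x \<noteq> 0 \<Longrightarrow> chi y \<noteq> 0 \<Longrightarrow> False"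
  shows "theta d M = 0"
  unfolding theta_def using assms by (intro sum.neutral) (auto simp: reps_def)

text \<open>For odd \<open>x\<close> and \<open>y\<close> the form is divisible by 8, so nothing
  contributes at \<open>4 * w\<close>; \<open>theta_7_scale\<close> then raises the
  exponent.\<close>

lemma theta_7_power_4:
  assumes "odd w" shows "theta 7 (4 ^ Suc e * w) = 0"
proof (induction e)
  case 0
  show ?case
  proof (rule theta_eq_0I)
    fix x y assume "x ^ 2 + 7 * y ^ 2 = 4 ^ Suc 0 * w" and "chi x \<noteq> 0" "chi y \<noteq> 0"
    then have "x ^ 2 + 7 * y ^ 2 = 4 * w" "odd x" "odd y" by (auto simp: chi_eq_0_iff)
    moreover from this obtain k l where "x ^ 2 = 8 * k + 1" "y ^ 2 = 8 * l + 1"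
      using odd_square by blast
    ultimately have "w = 2 * (k + 7 * l + 1)" by simp
    then show False using assms by simp
  qed
next
  case (Suc e)
  then show ?case using theta_7_scale[of "4 ^ e * w"] by (simp add: mult.assoc)
qed

text \<open>\<open>d\<close> is 2 modulo 3, so the form is divisible by 3 if \<open>x\<close> and
  \<open>y\<close> are prime to 3, and nothing contributes at \<open>w\<close>. The scaling lemmas
  raise the exponent.\<close>

lemma theta_power_9:
  assumes w: "\<not> 3 dvd w" and d: "d = 5 \<or> d = 2"
  shows "theta d (9 ^ e * w) = 0"
proof (induction e)
  case 0
  show ?case
  proof (rule theta_eq_0I)
    fix x y assume "x ^ 2 + d * y ^ 2 = 9 ^ 0 * w" and "chi x \<noteq> 0" "chi y \<noteq> 0"
    then have eq: "x ^ 2 + d * y ^ 2 = w" and "\<not> 3 dvd x" "\<not> 3 dvd y"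
      by (auto simp: chi_eq_0_iff)
    then have x: "x ^ 2 mod 3 = 1" and y: "y ^ 2 mod 3 = 1" by (simp_all add: sq_mod_3)
    from d show False
    proof
      assume "d = 5"
      then have "x ^ 2 + 5 * y ^ 2 = w" using eq by simp
      then show False using x y w by presburger
    next
      assume "d = 2"
      then have "x ^ 2 + 2 * y ^ 2 = w" using eq by simp
      then show False using x y w by presburger
    qed
  qed
next
  case (Suc e)
  then show ?case using theta_5_scale[of "9 ^ e * w"] theta_2_scale[of "9 ^ e * w"] d
    by (auto simp: mult.assoc)
qed

section \<open>Vanishing of the theta sums\<close>

text \<open>The factor 8 comes from \<open>24 * A + 8 = 8 * (3 * A + 1)\<close>. In the split case
  \<open>a + b \<surd>-7\<close> is the square of \<open>u + v \<surd>-7\<close>. Up to invertible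
  factors, the reflection exchanges \<open>x\<close> and \<open>y\<close> modulo 3
  (\<open>3 dvd a\<close>) and maps \<open>(x, y)\<close> to \<open>(x, - y)\<close> modulo 4
  (\<open>4 dvd b\<close>), so the sign comes from \<open>chi4\<close>.\<close>

lemma theta_7_prime:
  fixes p :: int
  assumes p: "prime p" "p mod 3 = 2" and w: "\<not> p dvd w"
  shows "theta 7 (8 * (p ^ (2 * e + 1) * w)) = 0"
proof (cases "p = 2")
  case True
  have eq: "8 * (2 ^ (2 * e + 1) * w) = 4 ^ Suc (Suc e) * w" by (simp add: power_mult)
  have "odd w" using w True by simp
  then show ?thesis unfolding True eq by (rule theta_7_power_4)
next
  case False
  then have odd: "odd p" using p(1) prime_odd_int[of p] prime_gt_1_int[of p] by force
  have w8: "\<not> p dvd 8 * w"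
  proof -
    have "\<not> p dvd 2" using primes_dvd_imp_eq[of p 2] p(1) False by auto
    then have "\<not> p dvd 2 ^ 3" using prime_dvd_power[OF p(1)] by blast
    then show ?thesis using p(1) w by (simp add: prime_dvd_mult_iff)
  qed
  have "theta 7 (p ^ (2 * e + 1) * (8 * w)) = 0"
  proof (cases "\<exists>r. p dvd r ^ 2 + 7")
    case False
    then show ?thesis using theta_inert[OF p(1) _ w8] by blast
  next
    case True
    then obtain u v where uv: "p = u ^ 2 + 7 * v ^ 2" using rep_7 p odd by blast
    define a b where "a = u ^ 2 - 7 * v ^ 2" and "b = 2 * (u * v)"
    have "a ^ 2 + 7 * b ^ 2 = p ^ 2" by (simp add: a_def b_def uv power2_eq_square algebra_simps)
    moreover have "p = (u ^ 2 + v ^ 2) + 3 * (2 * v ^ 2)" by (simp add: uv)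
    then have "p mod 3 = (u ^ 2 mod 3 + v ^ 2 mod 3) mod 3" by (simp only: mod_mult_self2 mod_add_eq)
    then have n3: "\<not> 3 dvd u" "\<not> 3 dvd v" using p(2) by (simp_all add: sq_mod_3 split: if_splits)
    then have b3: "\<not> 3 dvd b" unfolding b_def by (simp add: prime_dvd_mult_iff)
    have "3 dvd u ^ 2 - v ^ 2" using n3 by (simp add: sq_mod_3 flip: mod_eq_dvd_iff)
    then have "3 dvd (u ^ 2 - v ^ 2) - 3 * (2 * v ^ 2)" by (rule dvd_diff[OF _ dvd_triv_left])
    then have "3 dvd a" by (simp add: a_def)
    then obtain a3 where a3: "a = 3 * a3" by blast
    have "odd u \<noteq> odd v" using uv odd by simp
    then have "even (u * v)" by auto
    then obtain b4 where b4: "b = 4 * b4" unfolding b_def by auto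
    have "4 dvd a - 1" unfolding a_def using sq_parity_cases[of u] sq_parity_cases[of v] \<open>odd u \<noteq> odd v\<close>
      by (elim disjE exE conjE) presburger+
    then obtain a4 where a4: "a = 4 * a4 + 1" by (metis diff_add_cancel dvdE)
    have "chi X * chi Y = - (chi x * chi y)"
      if X: "p * X = a * x + 7 * b * y" and Y: "p * Y = b * x - a * y" for x y X Y
    proof -
      have "chi3 p * chi3 X * (chi3 p * chi3 Y) = chi3 (a * x + 7 * b * y) * chi3 (b * x - a * y)"
        by (simp only: chi3_mult[symmetric] X Y)
      also have "a * x + 7 * b * y = b * y + 3 * (a3 * x + 2 * b * y)" by (simp add: a3)
      also have "b * x - a * y = b * x + 3 * (- a3 * y)" by (simp add: a3)
      also have "chi3 (b * y + 3 * (a3 * x + 2 * b * y)) * chi3 (b * x + 3 * (- a3 * y)) =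
          (chi3 b * chi3 b) * (chi3 x * chi3 y)"
        unfolding chi3_add chi3_mult by (simp only: ac_simps)
      finally have 3: "chi3 X * chi3 Y = chi3 x * chi3 y"
        using p(2) by (simp add: chi3_sq[OF b3]) (simp add: chi3_def)
      have "(chi4 p * chi4 p) * (chi4 X * chi4 Y) = chi4 (p * X) * chi4 (p * Y)"
        unfolding chi4_mult by (simp only: ac_simps)
      also have "\<dots> = chi4 (a * x + 7 * b * y) * chi4 (b * x - a * y)"
        by (simp only: X Y)
      also have "a * x + 7 * b * y = x + 4 * (a4 * x + 7 * b4 * y)" by (simp add: a4 b4 algebra_simps)
      also have "b * x - a * y = - y + 4 * (b4 * x - a4 * y)" by (simp add: a4 b4 algebra_simps)
      finally have 4: "chi4 X * chi4 Y = - (chi4 x * chi4 y)"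
        unfolding chi4_add chi4_minus chi4_sq[OF odd] by simp
      have "chi X * chi Y = (chi3 X * chi3 Y) * (chi4 X * chi4 Y)" by (simp add: chi_def)
      then show ?thesis unfolding 3 4 by (simp add: chi_def)
    qed
    moreover have "\<not> p dvd 7"
    proof
      assume "p dvd 7"
      then have "p = 7" using primes_dvd_imp_eq[of p 7] p(1) by simp
      then show False using p(2) by simp
    qed
    moreover have "b \<noteq> 0" using b3 by auto
    ultimately show ?thesis using theta_split[OF p(1) odd _ _ _ _ _ w8, of 7 a b e] by auto
  qed
  then show ?thesis by (simp add: ac_simps)
qed

text \<open>The factor 6 comes from \<open>24 * A + 6 = 6 * (4 * A + 1)\<close>. In the split case
  \<open>a + b \<surd>-5\<close> is half the square of \<open>u + v \<surd>-5\<close>. Modulo 3,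
  \<open>a\<close> is -1 and \<open>b\<close> is 0, so the sign comes from \<open>chi3\<close>;
  modulo 4, \<open>a\<close> is 2 and \<open>b\<close> is odd, which leaves
  \<open>chi4 x * chi4 y\<close> unchanged.\<close>

lemma theta_5_prime:
  fixes p :: int
  assumes p: "prime p" "p mod 4 = 3" and w: "\<not> p dvd w"
  shows "theta 5 (6 * (p ^ (2 * e + 1) * w)) = 0"
proof (cases "p = 3")
  case True
  have eq: "6 * (3 ^ (2 * e + 1) * w) = 9 ^ Suc e * (2 * w)" by (simp add: power_mult)
  have "\<not> 3 dvd 2 * w" using w True by (simp add: prime_dvd_mult_iff)
  then show ?thesis unfolding True eq by (rule theta_power_9) simp
next
  case False
  have odd: "odd p" using p(2) by presburger
  have n3: "\<not> 3 dvd p" using primes_dvd_imp_eq[of 3 p] p(1) False by auto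
  have w6: "\<not> p dvd 6 * w"
  proof -
    have "\<not> p dvd 2" "\<not> p dvd 3" using primes_dvd_imp_eq[of p 2] primes_dvd_imp_eq[of p 3] p(1) odd False by auto
    then have "\<not> p dvd 2 * 3" using p(1) by (simp only: prime_dvd_mult_iff) simp
    then show ?thesis using p(1) w by (simp add: prime_dvd_mult_iff)
  qed
  have "theta 5 (p ^ (2 * e + 1) * (6 * w)) = 0"
  proof (cases "\<exists>r. p dvd r ^ 2 + 5")
    case False
    then show ?thesis using theta_inert[OF p(1) _ w6] by blast
  next
    case True
    then obtain u v where uv: "2 * p = u ^ 2 + 5 * v ^ 2" using rep_5 p False by blast
    have par: "even u \<longleftrightarrow> even v" using arg_cong[OF uv, of even] by simp
    have "odd u"
    proof
      assume "even u"
      then obtain u' v' where "u = 2 * u'" "v = 2 * v'" using par by (auto elim!: evenE)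
      then have "p = 2 * (u' ^ 2 + 5 * v' ^ 2)" using uv by (simp add: power2_eq_square)
      then show False using odd by simp
    qed
    then have oddu: "odd u \<and> odd v" using par by simp
    have "4 dvd u ^ 2 - 5 * v ^ 2" using sq_parity_cases[of u] sq_parity_cases[of v] oddu
      by (elim disjE exE conjE) presburger+
    then have "\<exists>a. u ^ 2 - 5 * v ^ 2 = 2 * a" by (auto elim!: dvdE intro: exI[of _ "2 * _"])
    then obtain a where a: "u ^ 2 - 5 * v ^ 2 = 2 * a" by blast
    define b where "b = u * v"
    have "4 * (a ^ 2 + 5 * b ^ 2) = (u ^ 2 - 5 * v ^ 2) ^ 2 + 20 * (u * v) ^ 2"
      by (simp add: a b_def power_mult_distrib)
    also have "\<dots> = (u ^ 2 + 5 * v ^ 2) ^ 2" by (simp add: power2_eq_square algebra_simps)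
    also have "\<dots> = 4 * p ^ 2" unfolding uv[symmetric] by (simp add: power2_eq_square)
    finally have "a ^ 2 + 5 * b ^ 2 = p ^ 2" by simp
    moreover have bodd: "odd b" using oddu by (simp add: b_def)
    have "4 dvd a - 2" using sq_parity_cases[of u] sq_parity_cases[of v] oddu a
      by (elim disjE exE conjE) presburger+
    then obtain a4 where a4: "a = 4 * a4 + 2" by (metis diff_add_cancel dvdE)
    have uv3: "(3 dvd u) \<noteq> (3 dvd v)"
    proof
      assume "(3 dvd u) = (3 dvd v)"
      then have "3 dvd (u ^ 2 + 2 * v ^ 2) + 3 * v ^ 2"
        by (intro dvd_add dvd_triv_left dvd_3_sq_add_double_sq)
      then have "3 dvd 2 * p" by (simp add: uv add.commute)
      then show False using n3 by (simp add: prime_dvd_mult_iff)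
    qed
    then have "3 dvd b" by (auto simp: b_def)
    then obtain b3 where b3: "b = 3 * b3" by blast
    have "(u ^ 2 + v ^ 2 - 1) - 3 * (2 * v ^ 2) = 2 * a - 1" by (simp flip: a)
    then have "3 dvd 2 * a - 1"
      using dvd_diff[OF dvd_3_sum_squares_minus_1[OF uv3] dvd_triv_left] by metis
    then have "3 dvd a - 2" by presburger
    then obtain a3 where a3: "a = 3 * a3 + 2" by (metis diff_add_cancel dvdE)
    have "chi X * chi Y = - (chi x * chi y)"
      if X: "p * X = a * x + 5 * b * y" and Y: "p * Y = b * x - a * y" for x y X Y
    proof -
      have "(chi3 p * chi3 p) * (chi3 X * chi3 Y) = chi3 (p * X) * chi3 (p * Y)"
        unfolding chi3_mult by (simp only: ac_simps)
      also have "p * X = - x + 3 * (a3 * x + x + 5 * b3 * y)" unfolding X a3 b3 by (simp add: algebra_simps)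
      also have "p * Y = y + 3 * (b3 * x - a3 * y - y)" unfolding Y a3 b3 by (simp add: algebra_simps)
      finally have 3: "chi3 X * chi3 Y = - (chi3 x * chi3 y)"
        unfolding chi3_add chi3_minus chi3_sq[OF n3] by simp
      \<comment> \<open>For odd \<open>c\<close>, \<open>x\<close> and \<open>y\<close> the product
        of the arguments is congruent to \<open>x * y\<close> modulo 4; otherwise both sides are
        0.\<close>
      have *: "chi4 (2 * x + c * y) * chi4 (c * x - 2 * y) = chi4 x * chi4 y"
        if "c \<in> {1, 3}" "x \<in> {0, 1, 2, 3}" "y \<in> {0, 1, 2, 3}" for c x y
        using that by (elim insertE emptyE) (simp_all add: chi4_def)
      have "b mod 4 \<in> {1, 3}" using bodd unfolding insert_iff empty_iff by presburger
      then have **: "chi4 (2 * x + b * y) * chi4 (b * x - 2 * y) = chi4 x * chi4 y"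
      proof -
        have "(2 * x + b * y) mod 4 = (2 * (x mod 4) + (b mod 4) * (y mod 4)) mod 4"
          "(b * x - 2 * y) mod 4 = ((b mod 4) * (x mod 4) - 2 * (y mod 4)) mod 4"
          unfolding cong_def[symmetric]
          by ((intro cong_add cong_diff cong_mult; simp add: cong_def), (intro cong_add cong_diff cong_mult; simp add: cong_def))
        then show ?thesis
          using *[OF \<open>b mod 4 \<in> {1, 3}\<close> mod4_mem mod4_mem, of x y] chi4_cong by (metis chi4_mod)
      qed
      have "(chi4 p * chi4 p) * (chi4 X * chi4 Y) = chi4 (p * X) * chi4 (p * Y)"
        unfolding chi4_mult by (simp only: ac_simps)
      also have "p * X = (2 * x + b * y) + 4 * (a4 * x + b * y)" unfolding X a4 by (simp add: algebra_simps)
      also have "p * Y = (b * x - 2 * y) + 4 * (- a4 * y)" unfolding Y a4 by (simp add: algebra_simps)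
      finally have 4: "chi4 X * chi4 Y = chi4 x * chi4 y"
        unfolding chi4_add chi4_sq[OF odd] ** by simp
      have "chi X * chi Y = (chi3 X * chi3 Y) * (chi4 X * chi4 Y)" by (simp add: chi_def)
      then show ?thesis unfolding 3 4 by (simp add: chi_def)
    qed
    moreover have "\<not> p dvd 5"
    proof
      assume "p dvd 5"
      then have "p = 5" using primes_dvd_imp_eq[of p 5] p(1) by simp
      then show False using p(2) by simp
    qed
    moreover have "b \<noteq> 0" using bodd by auto
    ultimately show ?thesis using theta_split[OF p(1) odd _ _ _ _ _ w6, of 5 a b e] by auto
  qed
  then show ?thesis by (simp add: ac_simps)
qed

text \<open>The factor 3 comes from \<open>24 * A + 3 = 3 * (8 * A + 1)\<close>. In the split case
  \<open>a + b \<surd>-2\<close> is the square of \<open>u + v \<surd>-2\<close>, with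
  \<open>a\<close> equal to 1 and \<open>b\<close> to 0 modulo 3, and \<open>a\<close> equal to -1
  and \<open>b\<close> to 2 modulo 4. The sign comes from \<open>chi3\<close>.\<close>

lemma theta_2_prime:
  fixes p :: int
  assumes p: "prime p" "odd p" "p mod 8 \<noteq> 1" and w: "\<not> p dvd w"
  shows "theta 2 (3 * (p ^ (2 * e + 1) * w)) = 0"
proof (cases "p = 3")
  case True
  have eq: "3 * (3 ^ (2 * e + 1) * w) = 9 ^ Suc e * w" by (simp add: power_mult)
  have "\<not> 3 dvd w" using w True by simp
  then show ?thesis unfolding True eq by (rule theta_power_9) simp
next
  case False
  have n3: "\<not> 3 dvd p" using primes_dvd_imp_eq[of 3 p] p(1) False by auto
  have n2: "\<not> p dvd 2" using primes_dvd_imp_eq[of p 2] p by auto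
  have w3: "\<not> p dvd 3 * w"
  proof -
    have "\<not> p dvd 3" using primes_dvd_imp_eq[of p 3] p(1) False by auto
    then show ?thesis using p(1) w by (simp add: prime_dvd_mult_iff)
  qed
  have "theta 2 (p ^ (2 * e + 1) * (3 * w)) = 0"
  proof (cases "\<exists>r. p dvd r ^ 2 + 2")
    case False
    then show ?thesis using theta_inert[OF p(1) _ w3] by blast
  next
    case True
    then obtain u v where uv: "p = u ^ 2 + 2 * v ^ 2" using rep_2 p by blast
    have "odd u" using p(2) uv by simp
    \<comment> \<open>This is where \<open>p mod 8 \<noteq> 1\<close> enters: for even
      \<open>v\<close>, \<open>p\<close> would be congruent to \<open>u ^ 2\<close>, hence to 1,
      modulo 8.\<close>
    moreover have "odd v"
    proof
      assume "even v"
      then obtain v' where "v = 2 * v'" by blast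
      moreover obtain k where "u ^ 2 = 8 * k + 1" using odd_square \<open>odd u\<close> by blast
      ultimately have "p = 1 + 8 * (k + v' ^ 2)" by (simp add: uv power2_eq_square)
      then have "p mod 8 = 1 mod 8" by (simp only: mod_mult_self2)
      then show False using p(3) by simp
    qed
    ultimately have oddu: "odd u \<and> odd v" by blast
    define a b where "a = u ^ 2 - 2 * v ^ 2" and "b = 2 * (u * v)"
    have "a ^ 2 + 2 * b ^ 2 = p ^ 2" by (simp add: a_def b_def uv power2_eq_square algebra_simps)
    moreover have "4 dvd a + 1" unfolding a_def
      using sq_parity_cases[of u] sq_parity_cases[of v] oddu by (elim disjE exE conjE) presburger+
    then obtain a4 where "a + 1 = 4 * a4" by blast
    then have a4: "a = 4 * a4 - 1" by simp
    obtain m where "u * v = 2 * m + 1" using oddu by (metis even_mult_iff oddE)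
    then have b4: "b = 4 * m + 2" by (simp add: b_def)
    have uv3: "(3 dvd u) \<noteq> (3 dvd v)" using dvd_3_sq_add_double_sq n3 uv by blast
    then have "3 dvd b" by (auto simp: b_def)
    then obtain b3 where b3: "b = 3 * b3" by blast
    have "3 dvd (u ^ 2 + v ^ 2 - 1) - 3 * v ^ 2"
      by (rule dvd_diff[OF dvd_3_sum_squares_minus_1[OF uv3] dvd_triv_left])
    then have "3 dvd a - 1" by (simp add: a_def algebra_simps)
    then obtain a3 where a3: "a = 3 * a3 + 1" by (metis diff_add_cancel dvdE)
    have "chi X * chi Y = - (chi x * chi y)"
      if X: "p * X = a * x + 2 * b * y" and Y: "p * Y = b * x - a * y" for x y X Y
    proof -
      have "(chi3 p * chi3 p) * (chi3 X * chi3 Y) = chi3 (p * X) * chi3 (p * Y)"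
        unfolding chi3_mult by (simp only: ac_simps)
      also have "p * X = x + 3 * (a3 * x + 2 * b3 * y)" unfolding X a3 b3 by (simp add: algebra_simps)
      also have "p * Y = - y + 3 * (b3 * x - a3 * y)" unfolding Y a3 b3 by (simp add: algebra_simps)
      finally have 3: "chi3 X * chi3 Y = - (chi3 x * chi3 y)"
        unfolding chi3_add chi3_minus chi3_sq[OF n3] by simp
      \<comment> \<open>For odd \<open>x\<close> and \<open>y\<close>, \<open>2 * x + y\<close> is
        congruent to \<open>- y\<close> modulo 4, so the two signs cancel.\<close>
      have **: "chi4 (- x) * chi4 (2 * x + y) = chi4 x * chi4 y"
      proof -
        have *: "chi4 (- x) * chi4 (2 * x + y) = chi4 x * chi4 y"
          if "x \<in> {0, 1, 2, 3}" "y \<in> {0, 1, 2, 3}" for x y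
          using that by (elim insertE emptyE) (simp_all add: chi4_def)
        have "chi4 (- x) = chi4 (- (x mod 4))" "chi4 (2 * x + y) = chi4 (2 * (x mod 4) + y mod 4)"
          by (rule chi4_cong, unfold cong_def[symmetric],
          intro cong_add cong_diff cong_mult cong_minus_minus_iff[THEN iffD2]; simp add: cong_def)+
        then show ?thesis using *[OF mod4_mem mod4_mem, of x y] by (simp only: chi4_mod)
      qed
      have "(chi4 p * chi4 p) * (chi4 X * chi4 Y) = chi4 (p * X) * chi4 (p * Y)"
        unfolding chi4_mult by (simp only: ac_simps)
      also have "p * X = - x + 4 * (a4 * x + 2 * m * y + y)" unfolding X a4 b4 by (simp add: algebra_simps)
      also have "p * Y = (2 * x + y) + 4 * (m * x - a4 * y)" unfolding Y a4 b4 by (simp add: algebra_simps)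
      finally have 4: "chi4 X * chi4 Y = chi4 x * chi4 y"
        unfolding chi4_add chi4_sq[OF p(2)] ** by simp
      have "chi X * chi Y = (chi3 X * chi3 Y) * (chi4 X * chi4 Y)" by (simp add: chi_def)
      then show ?thesis unfolding 3 4 by (simp add: chi_def)
    qed
    moreover have "b \<noteq> 0" using b4 by presburger
    ultimately show ?thesis using theta_split[OF p(1,2) _ n2 _ _ _ w3, of a b e] by auto
  qed
  then show ?thesis by (simp add: ac_simps)
qed

section \<open>The congruences\<close>

text \<open>\<open>theta\<close> is four times the coefficient to which \<open>B\<close> is
  congruent, as an equality of integers. Negative arguments are covered by the convention
  \<open>B = 0\<close>.\<close>

lemma B_3_cong_0:
  fixes A :: int and v :: nat
  assumes "v \<ge> 1" and theta: "theta (int v) (24 * A + 1 + int v) = 0"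
  shows "[B 3 v A = 0] (mod 3)"
proof (cases "A < 0")
  case True
  then show ?thesis by (simp add: B_def)
next
  case False
  define N where "N = nat A"
  have A: "A = int N" using False by (simp add: N_def)
  have cancel4: "s = 0" if "4 * s = 0" for s :: int using that by simp
  have "theta (int v) (24 * int N + 1 + int v) = 0" using theta unfolding A .
  then have 0: "fps_nth (pent_sum 1 N * pent_sum v N) N = 0"
    unfolding theta_pent_sum[OF assms(1)] pent_sum_nth
    by (rule cancel4)
  have B: "B 3 v A = card (regular_bipartitions 3 v N)"
    using False by (simp only: B_def N_def if_False)
  have "[int (B 3 v A) = int 0] (mod int 3)"
    using card_regular_bipartitions_3_cong[OF assms(1), of N] unfolding 0 B of_nat_0 of_nat_numeral .
  then show ?thesis by (simp only: cong_int_iff)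
qed

text \<open>The division by \<open>c\<close> is exact because \<open>(R * q) ^ 2\<close> is 1 modulo
  \<open>c\<close>. The right-hand side shows the exponent of \<open>q\<close>.\<close>

lemma theta_argument:
  fixes c R q n j :: int
  assumes "c > 0" "c dvd (R * q) ^ 2 - 1"
  shows "c * (R ^ 2 * q ^ 2 * n + (R ^ 2 * q * (c * j + q) - 1) div c) + 1 =
    R ^ 2 * q * (c * (q * n + j) + q)"
proof -
  have "R ^ 2 * q * (c * j + q) - 1 = c * (R ^ 2 * q * j) + ((R * q) ^ 2 - 1)"
    by (simp add: power2_eq_square algebra_simps)
  moreover have "c dvd c * (R ^ 2 * q * j) + ((R * q) ^ 2 - 1)"
    by (intro dvd_add dvd_triv_left assms)
  ultimately have "c dvd R ^ 2 * q * (c * j + q) - 1" by (simp only:)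
  then obtain z where z: "R ^ 2 * q * (c * j + q) - 1 = c * z" by blast
  have "c * (R ^ 2 * q ^ 2 * n + z) + 1 = c * R ^ 2 * q ^ 2 * n + (c * z + 1)"
    by (simp add: algebra_simps)
  also have "\<dots> = R ^ 2 * q * (c * (q * n + j) + q)"
    unfolding z[symmetric] by (simp add: power2_eq_square algebra_simps)
  finally have "c * (R ^ 2 * q ^ 2 * n + z) + 1 = R ^ 2 * q * (c * (q * n + j) + q)" .
  moreover have "c * z div c = z" using assms(1) by simp
  ultimately show ?thesis unfolding z by (simp only:)
qed

text \<open>The primes may repeat, so \<open>q\<close> can divide \<open>R\<close>; the square
  contributes an even exponent, and the total exponent stays odd.\<close>

lemma square_times_prime_decompose:
  fixes R q w :: int
  assumes "prime q" "R \<noteq> 0" "\<not> q dvd w"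
  obtains e w' where "R ^ 2 * q * w = q ^ (2 * e + 1) * w'" "\<not> q dvd w'"
proof -
  have "\<not> is_unit q" using assms(1) not_prime_unit by blast
  then obtain r where "R = q ^ multiplicity q R * r" and r: "\<not> q dvd r"
    using multiplicity_decompose'[of R q] assms(2) by metis
  then obtain e where R: "R = q ^ e * r" by blast
  have "R ^ 2 * q * w = q ^ (2 * e + 1) * (r ^ 2 * w)"
    unfolding R power_add mult_2 by (simp add: power2_eq_square ac_simps)
  moreover have "\<not> q dvd r ^ 2 * w"
    using r assms by (simp add: prime_dvd_mult_iff prime_dvd_power_iff)
  ultimately show ?thesis by (rule that)
qed

text \<open>The common frame of the three parts, with \<open>(v, c, m)\<close> equal to
  \<open>(7, 3, 8)\<close>, \<open>(5, 4, 6)\<close> and \<open>(2, 8, 3)\<close>. The argument of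
  \<open>theta\<close> is \<open>m\<close> times \<open>c * A + 1\<close>, which the last prime
  divides to an odd power.\<close>

lemma B_3_prime_family:
  fixes p :: "nat \<Rightarrow> nat" and v n k :: nat and c m j :: int
  assumes v: "v \<ge> 1" and c: "c > 0" "c * m = 24" "1 + int v = m"
    and p: "\<And>i. i \<in> {1..k+1} \<Longrightarrow> prime (p i)"
    and cong: "c dvd (\<Prod>i=1..k+1. int (p i)) ^ 2 - 1"
    and pc: "\<not> int (p (k+1)) dvd c" and j: "\<not> int (p (k+1)) dvd j"
    and theta: "\<And>e w. \<not> int (p (k+1)) dvd w \<Longrightarrow>
      theta (int v) (m * (int (p (k+1)) ^ (2 * e + 1) * w)) = 0"
  shows "[B 3 v ((\<Prod>i=1..k. int (p i) ^ 2) * int (p (k+1)) ^ 2 * int n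
     + ((\<Prod>i=1..k. int (p i) ^ 2) * int (p (k+1)) * (c * j + int (p (k+1))) - 1) div c)
     = 0] (mod 3)" (is "[B 3 v ?A = 0] (mod 3)")
proof (rule B_3_cong_0[OF v])
  define q where "q = int (p (k+1))"
  define R where "R = (\<Prod>i=1..k. int (p i))"
  have q: "prime q" using p[of "k+1"] by (simp add: q_def)
  have "p i \<noteq> 0" if "i \<in> {1..k}" for i using p[of i] that by (auto dest: prime_gt_0_nat)
  then have R: "R \<noteq> 0" by (simp add: R_def)
  have "(\<Prod>i=1..k+1. int (p i)) = R * q" by (simp add: R_def q_def)
  then have "c dvd (R * q) ^ 2 - 1" using cong by simp
  then have A: "c * ?A + 1 = R ^ 2 * q * (c * (q * int n + j) + q)"
    unfolding prod_power_distrib[symmetric] R_def[symmetric] q_def[symmetric]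
    by (rule theta_argument[OF c(1)])
  \<comment> \<open>Modulo \<open>q\<close> the number is \<open>c * j\<close>.\<close>
  have "\<not> q dvd c * (q * int n + j) + q"
    using q pc j unfolding q_def[symmetric]
    by (simp add: prime_dvd_mult_iff dvd_add_left_iff dvd_add_right_iff)
  then obtain e w where w: "R ^ 2 * q * (c * (q * int n + j) + q) = q ^ (2 * e + 1) * w" "\<not> q dvd w"
    using square_times_prime_decompose[OF q R] by metis
  have "24 * ?A + 1 + int v = c * m * ?A + m"
    unfolding c(2) unfolding c(3)[symmetric] by (simp only: add.assoc)
  also have "\<dots> = m * (c * ?A + 1)" by (simp only: distrib_left ac_simps mult_1_right)
  also have "\<dots> = m * (q ^ (2 * e + 1) * w)" by (simp only: A w)
  finally show "theta (int v) (24 * ?A + 1 + int v) = 0"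
    using theta[folded q_def, OF w(2)] by (simp only:)
qed

lemma odd_prod_sq:
  assumes "\<And>i. i \<in> A \<Longrightarrow> odd (p i :: nat)" "finite A"
  shows "8 dvd (\<Prod>i\<in>A. int (p i)) ^ 2 - 1"
proof -
  have "odd (\<Prod>i\<in>A. int (p i))" using assms by (simp add: even_prod_iff)
  then show ?thesis using sq_parity_cases[of "\<Prod>i\<in>A. int (p i)"] by auto
qed

theorem theorem1p2:
  fixes k n :: nat
  shows
   "(\<forall>(p :: nat \<Rightarrow> nat) (j :: int).
       (\<forall>i\<in>{1..k+1}. prime (p i) \<and> [p i = 2] (mod 3)) \<longrightarrow>
       \<not> int (p (k+1)) dvd j \<longrightarrow>
       [B 3 7 ((\<Prod>i=1..k. int (p i) ^ 2) * int (p (k+1)) ^ 2 * int n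
               + ((\<Prod>i=1..k. int (p i) ^ 2) * int (p (k+1)) * (3 * j + int (p (k+1))) - 1) div 3)
        = 0] (mod 3))
    \<and>
    (\<forall>(p :: nat \<Rightarrow> nat) (j :: int).
       (\<forall>i\<in>{1..k+1}. prime (p i) \<and> [p i = 3] (mod 4)) \<longrightarrow>
       \<not> int (p (k+1)) dvd j \<longrightarrow>
       [B 3 5 ((\<Prod>i=1..k. int (p i) ^ 2) * int (p (k+1)) ^ 2 * int n
               + ((\<Prod>i=1..k. int (p i) ^ 2) * int (p (k+1)) * (4 * j + int (p (k+1))) - 1) div 4)
        = 0] (mod 3))
    \<and>
    (\<forall>(p :: nat \<Rightarrow> nat) (j :: int).
       (\<forall>i\<in>{1..k+1}. prime (p i) \<and> odd (p i) \<and> [p i \<noteq> 1] (mod 8)) \<longrightarrow>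
       \<not> int (p (k+1)) dvd j \<longrightarrow>
       [B 3 2 ((\<Prod>i=1..k. int (p i) ^ 2) * int (p (k+1)) ^ 2 * int n
               + ((\<Prod>i=1..k. int (p i) ^ 2) * int (p (k+1)) * (8 * j + int (p (k+1))) - 1) div 8)
        = 0] (mod 3))"
proof (intro conjI allI impI)
  fix p :: "nat \<Rightarrow> nat" and j :: int
  assume p: "\<forall>i\<in>{1..k+1}. prime (p i) \<and> [p i = 2] (mod 3)" and j: "\<not> int (p (k+1)) dvd j"
  have m: "int (p i) mod 3 = 2" if "i \<in> {1..k+1}" for i
  proof -
    have "p i mod 3 = 2" using p that by (simp add: cong_def)
    then have "int (p i mod 3) = int 2" by (simp only:)
    then show ?thesis by (simp only: zmod_int of_nat_numeral)
  qed
  have "\<not> 3 dvd (\<Prod>i=1..k+1. int (p i))"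
    using m by (subst prime_dvd_prod_iff) (force simp: dvd_eq_mod_eq_0)+
  then have 3: "3 dvd (\<Prod>i=1..k+1. int (p i)) ^ 2 - 1"
    using sq_mod_3[of "\<Prod>i=1..k+1. int (p i)"] by presburger
  have pk: "prime (int (p (k+1)))" using bspec[OF p, of "k+1"] by simp
  have mk: "int (p (k+1)) mod 3 = 2" using m[of "k+1"] by simp
  have pc: "\<not> int (p (k+1)) dvd 3"
    using primes_dvd_imp_eq[OF pk, of 3] mk by auto
  have P: "prime (p i)" if "i \<in> {1..k+1}" for i using p that by blast
  have T: "theta (int 7) (8 * (int (p (k+1)) ^ (2 * e + 1) * w)) = 0" if "\<not> int (p (k+1)) dvd w" for e w
    unfolding of_nat_numeral by (rule theta_7_prime[OF pk mk that])
  show "[B 3 7 ((\<Prod>i=1..k. int (p i) ^ 2) * int (p (k+1)) ^ 2 * int n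
      + ((\<Prod>i=1..k. int (p i) ^ 2) * int (p (k+1)) * (3 * j + int (p (k+1))) - 1) div 3)
      = 0] (mod 3)"
    by (rule B_3_prime_family[where m = 8, OF _ _ _ _ P 3 pc j T]) simp_all
next
  fix p :: "nat \<Rightarrow> nat" and j :: int
  assume p: "\<forall>i\<in>{1..k+1}. prime (p i) \<and> [p i = 3] (mod 4)" and j: "\<not> int (p (k+1)) dvd j"
  have m: "p i mod 4 = 3" if "i \<in> {1..k+1}" for i
    using p that by (auto simp: cong_def)
  then have odd: "odd (p i)" if "i \<in> {1..k+1}" for i using m[OF that] by presburger
  have 4: "4 dvd (\<Prod>i=1..k+1. int (p i)) ^ 2 - 1"
    using odd_prod_sq[of "{1..k+1}" p] odd by (auto intro: dvd_trans[of 4 8])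
  have pk: "prime (int (p (k+1)))" using bspec[OF p, of "k+1"] by simp
  have "int (p (k+1) mod 4) = int 3" using m[of "k+1"] by simp
  then have mk: "int (p (k+1)) mod 4 = 3" by (simp only: zmod_int of_nat_numeral)
  have "int (p (k+1)) \<noteq> 2" using mk by auto
  then have "\<not> int (p (k+1)) dvd 2" using primes_dvd_imp_eq[OF pk, of 2] by auto
  then have pc: "\<not> int (p (k+1)) dvd 4" using prime_dvd_power[OF pk, of 2 2] by auto
  have P: "prime (p i)" if "i \<in> {1..k+1}" for i using p that by blast
  have T: "theta (int 5) (6 * (int (p (k+1)) ^ (2 * e + 1) * w)) = 0" if "\<not> int (p (k+1)) dvd w" for e w
    unfolding of_nat_numeral by (rule theta_5_prime[OF pk mk that])
  show "[B 3 5 ((\<Prod>i=1..k. int (p i) ^ 2) * int (p (k+1)) ^ 2 * int n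
      + ((\<Prod>i=1..k. int (p i) ^ 2) * int (p (k+1)) * (4 * j + int (p (k+1))) - 1) div 4)
      = 0] (mod 3)"
    by (rule B_3_prime_family[where m = 6, OF _ _ _ _ P 4 pc j T]) simp_all
next
  fix p :: "nat \<Rightarrow> nat" and j :: int
  assume p: "\<forall>i\<in>{1..k+1}. prime (p i) \<and> odd (p i) \<and> [p i \<noteq> 1] (mod 8)"
    and j: "\<not> int (p (k+1)) dvd j"
  have 8: "8 dvd (\<Prod>i=1..k+1. int (p i)) ^ 2 - 1"
    using odd_prod_sq[of "{1..k+1}" p] p by auto
  have pk: "prime (int (p (k+1)))" and odd: "odd (int (p (k+1)))"
    and m: "p (k+1) mod 8 \<noteq> 1"
    using bspec[OF p, of "k+1"] by (simp_all add: cong_def)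
  have "int (p (k+1) mod 8) \<noteq> int 1" using m by (simp only: of_nat_eq_iff not_False_eq_True)
  then have mk: "int (p (k+1)) mod 8 \<noteq> 1" by (simp only: zmod_int of_nat_numeral of_nat_1 not_False_eq_True)
  have "int (p (k+1)) \<noteq> 2" using odd by auto
  then have "\<not> int (p (k+1)) dvd 2" using primes_dvd_imp_eq[OF pk, of 2] by auto
  then have pc: "\<not> int (p (k+1)) dvd 8" using prime_dvd_power[OF pk, of 2 3] by auto
  have P: "prime (p i)" if "i \<in> {1..k+1}" for i using p that by blast
  have T: "theta (int 2) (3 * (int (p (k+1)) ^ (2 * e + 1) * w)) = 0" if "\<not> int (p (k+1)) dvd w" for e w
    unfolding of_nat_numeral by (rule theta_2_prime[OF pk odd mk that])
  show "[B 3 2 ((\<Prod>i=1..k. int (p i) ^ 2) * int (p (k+1)) ^ 2 * int n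
      + ((\<Prod>i=1..k. int (p i) ^ 2) * int (p (k+1)) * (8 * j + int (p (k+1))) - 1) div 8)
      = 0] (mod 3)"
    by (rule B_3_prime_family[where m = 3, OF _ _ _ _ P 8 pc j T]) simp_all
qed

end
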